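(* Let $k\ge 1$ and $t\ge 3$ be integers, $\varepsilon>0$ a constant, and let $P:\{0,1\}^k\to\{0,1\}$ be $(t-1)$-wise uniform supporting. Let $\mathcal{I}$ be a random instance of $\mathrm{CSP}(P)$ with $n$ variables and $m\le n^{t/2-\varepsilon}$ constraints. Then there is $r=\Omega(n^{\varepsilon/(t-2)})$ such that, with high probability, $N_+^r(L_{\mathcal{I}})$ is nonempty (the $r$-round Lovász–Schrijver$_+$ relaxation of $\mathcal{I}$ has value $1$).
   Context: $P$ is $s$-wise uniform supporting if there is a distribution $\mu$ on $\{0,1\}^k$ supported on $P^{-1}(1)$ such that $\Pr_{z\sim\mu}[z_T=\alpha]=2^{-|T|}$ for all $T\subseteq[k]$ with $1\le|T|\le s$ and all $\alpha\in\{0,1\}^T$. An instance of $\mathrm{CSP}(P)$ on $x_1,\dots,x_n\in\{0,1\}$ is a multiset of constraints $(c,S)$, $c\in\{0,1\}^k$, $S\in[n]^k$, meaning $P(x_S\oplus c)=1$. A random instance has its $m$ constraints chosen independently and uniformly among all $2^kn^k$ pairs. "With high probability" means with probability $1-o(1)$ as $n\to\infty$ with $k,t,\varepsilon,P$ fixed. For $a\in\mathbb{R}$ and $b\in\{0,1\}$ let $a^{(b)}=a$ if $b=0$ and $1-a$ if $b=1$. Let $F=P^{-1}(0)$. Then $L_{\mathcal{I}}$ is the set of linear inequalities $\sum_{i=1}^k x_{S_i}^{(c_i\oplus f_i)}\ge 1$ for $(c,S)\in\mathcal{I}$, $f\in F$; let $K\subseteq\mathbb{R}^n$ be the polytope they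 define, and $N_+^r(L_{\mathcal{I}})=N_+^r(K)$. For a convex set $K\subseteq\mathbb{R}^n$ let $\widetilde K=\{(\lambda,\lambda x):\lambda>0,x\in K\}\subseteq\mathbb{R}^{n+1}$ (coordinates indexed $0,1,\dots,n$). $N_+(\widetilde K)$ is the set of $y\in\mathbb{R}^{n+1}$ for which there is a symmetric positive semidefinite $(n+1)\times(n+1)$ matrix $Y$ with $Y_{ii}=Y_{i0}=y_i$ for all $i$, and, writing $Y_i$ for the $i$-th column, $Y_i\in\widetilde K$ and $Y_0-Y_i\in\widetilde K$ for all $i\in[n]$. $N_+(K)=N_+(\widetilde K)\cap\{y_0=1\}$ (identified with a subset of $\mathbb{R}^n$), and $N_+^r(K)=N_+(N_+^{r-1}(K))$, $N_+^0(K)=K$.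
   Formalization: The cone over K is taken with λ ≥ 0 (apex included, the standard Lovász–Schrijver definition) instead of λ > 0; with λ > 0, N_+^r(K) is empty for every K once r ≥ 2 and n ≥ 1, so the claim would be false. *)

theory Defs
  imports
    "HOL-Probability.Probability"
    "HOL-Library.Landau_Symbols"
    "Jordan_Normal_Form.Matrix"
begin

text \<open>
  The arity \<open>k\<close> is the cardinality of a finite type \<open>'k\<close>, and \<open>{0,1}\<^sup>k\<close> is \<open>'k \<Rightarrow> bool\<close>.
  The number of variables \<open>n\<close> varies, so \<open>\<real>\<^sup>n\<close> is \<open>carrier_vec n\<close>; the variables \<open>x\<^sub>1, \<dots>, x\<^sub>n\<close>
  have the indices \<open>0, \<dots>, n - 1\<close>.
\<close>

type_synonym 'k constraint = "('k \<Rightarrow> bool) \<times> ('k \<Rightarrow> nat)"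

definition uniform_supporting :: "nat \<Rightarrow> (('k::finite \<Rightarrow> bool) \<Rightarrow> bool) \<Rightarrow> bool" where
  "uniform_supporting s P \<longleftrightarrow>
     (\<exists>\<mu> :: ('k \<Rightarrow> bool) pmf. set_pmf \<mu> \<subseteq> {z. P z} \<and>
        (\<forall>T \<alpha>. 1 \<le> card T \<and> card T \<le> s \<longrightarrow>
           measure_pmf.prob \<mu> {z. \<forall>i\<in>T. z i = \<alpha> i} = (1 / 2) ^ card T))"

definition constraints :: "nat \<Rightarrow> 'k::finite constraint set" where
  "constraints n = UNIV \<times> {S. \<forall>i. S i < n}"

definition random_instance :: "nat \<Rightarrow> nat \<Rightarrow> 'k::finite constraint multiset pmf" where
  "random_instance n m = map_pmf mset (replicate_pmf m (pmf_of_set (constraints n)))"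

definition literal :: "real \<Rightarrow> bool \<Rightarrow> real" where
  "literal a b = (if b then 1 - a else a)"

text \<open>Exclusive or is \<open>\<noteq>\<close> on \<open>bool\<close>.\<close>

definition csp_polytope ::
  "nat \<Rightarrow> (('k::finite \<Rightarrow> bool) \<Rightarrow> bool) \<Rightarrow> 'k constraint multiset \<Rightarrow> real vec set" where
  "csp_polytope n P I =
     {x \<in> carrier_vec n. \<forall>(c, S) \<in> set_mset I. \<forall>f. \<not> P f \<longrightarrow>
        (\<Sum>i\<in>UNIV. literal (x $ S i) (c i \<noteq> f i)) \<ge> 1}"

definition psd_mat :: "nat \<Rightarrow> real mat \<Rightarrow> bool" where
  "psd_mat d Y \<longleftrightarrow> Y \<in> carrier_mat d d \<and> transpose_mat Y = Y \<and>
     (\<forall>v \<in> carrier_vec d. v \<bullet> (Y *\<^sub>v v) \<ge> 0)"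

text \<open>
  The apex \<open>\<lambda> = 0\<close> belongs to the cone, as in the usual Lovasz-Schrijver definition. Without it,
  two rounds would always give the empty set for \<open>n \<ge> 1\<close>: a point of \<open>N\<^sub>+(K)\<close> would have all its
  coordinates strictly between 0 and 1, whereas the normalised column \<open>Y\<^sub>i / Y\<^sub>0\<^sub>i\<close> has
  \<open>i\<close>-th coordinate 1.
\<close>

definition homog_cone :: "real vec set \<Rightarrow> real vec set" where
  "homog_cone K = {vCons l (l \<cdot>\<^sub>v x) | l x. l \<ge> 0 \<and> x \<in> K}"

definition N_plus_cone :: "nat \<Rightarrow> real vec set \<Rightarrow> real vec set" where
  "N_plus_cone n C =
     {y \<in> carrier_vec (n + 1). \<exists>Y. psd_mat (n + 1) Y \<and>
        (\<forall>i \<in> {0..n}. Y $$ (i, i) = y $ i \<and> Y $$ (i, 0) = y $ i) \<and>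
        (\<forall>i \<in> {1..n}. col Y i \<in> C \<and> col Y 0 - col Y i \<in> C)}"

definition N_plus :: "nat \<Rightarrow> real vec set \<Rightarrow> real vec set" where
  "N_plus n K = {x \<in> carrier_vec n. vCons 1 x \<in> N_plus_cone n (homog_cone K)}"

end

theory Submission
  imports Defs
begin

text \<open>
  Give a set \<open>E\<close> of constraints, relative to a set \<open>C\<close> of variables that are already fixed, the
  surplus \<open>|V| + |V - C| - (2k - t) |E|\<close>, where \<open>V\<close> is the set of variables of \<open>E\<close>. It is
  submodular in \<open>E\<close>. If all nonempty subsets of \<open>E\<close> have positive surplus, then some constraint
  of \<open>E\<close> has at most \<open>t - 1\<close> positions that are fixed or shared, so by \<open>(t - 1)\<close>-wise uniformity
  it integrates out of the product of the local distributions. Hence that product has total mass 1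
  for every assignment of \<open>C\<close>, and it has uniform marginals if the surpluses are at least 2.

  In a random instance all small sets \<open>E\<close> have surplus at least \<open>d |E|\<close> for a constant \<open>d > 0\<close>,
  by a union bound over \<open>E\<close> and \<open>V\<close>. First fix all variables of the small sets of surplus 1:
  afterwards all remaining small sets have surplus at least 2. From then on the current point is
  0 or 1 on the fixed variables and 1/2 elsewhere. The sets of surplus exactly 2 fall into clusters
  with disjoint sets of unfixed variables, and the protection matrix is the second moment matrix of
  the product over the clusters of the local distributions, so its covariance part is block
  diagonal and positive semidefinite. Conditioning on one variable and then sampling its cluster
  leaves all other variables at 1/2, restores surplus at least 2, and uses up only a bounded part
  of the slack \<open>d |E|\<close>, so this can be repeated \<open>r\<close> times.
\<close>

unbundle no vec_syntax
unbundle no inner_syntax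

section \<open>Surplus of set families\<close>

definition surplus :: "('e \<Rightarrow> 'v set) \<Rightarrow> int \<Rightarrow> 'v set \<Rightarrow> 'e set \<Rightarrow> int" where
  "surplus S \<kappa> C A =
     int (card (\<Union>(S ` A))) + int (card (\<Union>(S ` A) - C)) - \<kappa> * int (card A)"

definition expanding ::
  "('e \<Rightarrow> 'v set) \<Rightarrow> int \<Rightarrow> 'v set \<Rightarrow> 'e set \<Rightarrow> nat \<Rightarrow> (nat \<Rightarrow> real) \<Rightarrow> bool" where
  "expanding S \<kappa> C L s g \<longleftrightarrow>
     (\<forall>A\<subseteq>L. A \<noteq> {} \<and> card A \<le> s \<longrightarrow> g (card A) \<le> real_of_int (surplus S \<kappa> C A))"

lemma expandingD:
  "expanding S \<kappa> C L s g \<Longrightarrow> A \<subseteq> L \<Longrightarrow> A \<noteq> {} \<Longrightarrow> card A \<le> s \<Longrightarrow>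
     g (card A) \<le> real_of_int (surplus S \<kappa> C A)"
  by (simp add: expanding_def)

lemma surplus_empty [simp]: "surplus S \<kappa> C {} = 0"
  by (simp add: surplus_def)

lemma card_Un_Diff_Int:
  assumes "finite A" "finite B"
  shows "card (A \<union> B - X) + card (A \<inter> B - X) = card (A - X) + card (B - X)"
proof -
  have "A \<union> B - X = (A - X) \<union> (B - X)" "A \<inter> B - X = (A - X) \<inter> (B - X)" by auto
  thus ?thesis using card_Un_Int[of "A - X" "B - X"] assms by simp
qed

locale scope_family =
  fixes S :: "'e \<Rightarrow> 'v set"
  assumes finite_scope: "finite (S e)"
begin

abbreviation vars :: "'e set \<Rightarrow> 'v set" where
  "vars A \<equiv> \<Union>(S ` A)"

lemma finite_vars: "finite A \<Longrightarrow> finite (vars A)"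
  by (simp add: finite_scope)

lemma surplus_Un_Int:
  fixes A B :: "'e set"
  assumes "finite A" "finite B"
  defines "X \<equiv> vars A \<inter> vars B - vars (A \<inter> B)"
  shows "surplus S \<kappa> C (A \<union> B) + surplus S \<kappa> C (A \<inter> B) =
    surplus S \<kappa> C A + surplus S \<kappa> C B - int (card X) - int (card (X - C))"
proof -
  have vars_card: "int (card (vars (A \<union> B) - D)) + int (card (vars (A \<inter> B) - D)) =
      int (card (vars A - D)) + int (card (vars B - D)) - int (card (X - D))" for D
  proof -
    have "card (vars A \<inter> vars B - D) = card (vars (A \<inter> B) - D) + card (X - D)"
      using assms finite_vars[of "A \<inter> B"] finite_vars[of A]
      by (subst card_Un_disjoint[symmetric]) (auto simp: X_def intro: arg_cong[where f = card])
    thus ?thesis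
      using card_Un_Diff_Int[of "vars A" "vars B" D] assms finite_vars by (simp add: Un_Diff)
  qed
  have "\<kappa> * int (card (A \<union> B)) + \<kappa> * int (card (A \<inter> B)) =
      \<kappa> * int (card A) + \<kappa> * int (card B)"
    using card_Un_Int[OF assms(1,2)] by (metis distrib_left of_nat_add)
  with vars_card[of "{}"] vars_card[of C] show ?thesis
    by (simp add: surplus_def)
qed

lemma surplus_submodular:
  "finite A \<Longrightarrow> finite B \<Longrightarrow>
     surplus S \<kappa> C (A \<union> B) + surplus S \<kappa> C (A \<inter> B) \<le> surplus S \<kappa> C A + surplus S \<kappa> C B"
  using surplus_Un_Int[of A B \<kappa> C] by linarith

lemma surplus_Un_disjoint:
  "finite A \<Longrightarrow> finite B \<Longrightarrow> A \<inter> B = {} \<Longrightarrow>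
     surplus S \<kappa> C (A \<union> B) = surplus S \<kappa> C A + surplus S \<kappa> C B
       - int (card (vars A \<inter> vars B)) - int (card (vars A \<inter> vars B - C))"
  using surplus_Un_Int[of A B \<kappa> C] by simp

lemma surplus_Un_fixed:
  assumes "finite A"
  shows "surplus S \<kappa> (C \<union> X) A = surplus S \<kappa> C A - int (card (vars A \<inter> X - C))"
proof -
  have "card (vars A - C) = card (vars A - (C \<union> X)) + card (vars A \<inter> X - C)"
    using finite_vars[OF assms]
    by (subst card_Un_disjoint[symmetric]) (auto intro: arg_cong[where f = card])
  thus ?thesis by (simp add: surplus_def)
qed

end

section \<open>Tight sets and clusters\<close>

locale expanding_family = scope_family S for S :: "'e \<Rightarrow> 'v set" +
  fixes \<kappa> :: int and C :: "'v set" and L :: "'e set" and s :: nat and h :: int and d a :: real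
  assumes finite_L: "finite L" and d_pos: "d > 0" and h_le_2: "h \<le> 2"
    and L_expanding: "expanding S \<kappa> C L s (\<lambda>j. max h (d * j - a))"
    and s_large: "2 * (h + a) \<le> d * s"
begin

definition tight :: "'e set set" where
  "tight = {A. A \<subseteq> L \<and> A \<noteq> {} \<and> card A \<le> s \<and> surplus S \<kappa> C A \<le> h}"

definition cluster :: "'v \<Rightarrow> 'e set" where
  "cluster v = \<Union>{A \<in> tight. v \<in> vars A}"

lemma finite_subset_L: "A \<subseteq> L \<Longrightarrow> finite A"
  using finite_L finite_subset by blast

lemma surplus_ge:
  assumes "A \<subseteq> L" "A \<noteq> {}" "card A \<le> s"
  shows "h \<le> surplus S \<kappa> C A" "d * card A - a \<le> surplus S \<kappa> C A"
  using expandingD[OF L_expanding assms] by auto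

lemma tight_subset: "A \<in> tight \<Longrightarrow> A \<subseteq> L"
  by (simp add: tight_def)

lemma card_tight_le:
  assumes "A \<in> tight"
  shows "d * card A \<le> h + a"
proof -
  have "surplus S \<kappa> C A \<le> h" "d * card A - a \<le> surplus S \<kappa> C A"
    using assms surplus_ge(2)[of A] by (simp_all add: tight_def)
  thus ?thesis by linarith
qed

lemma double_card_tight_le:
  assumes "A \<in> tight"
  shows "2 * card A \<le> s"
proof -
  have "d * (2 * card A) \<le> d * s" using card_tight_le[OF assms] s_large by simp
  hence "real (2 * card A) \<le> real s" using d_pos by (subst (asm) mult_le_cancel_left_pos) auto
  thus ?thesis by linarith
qed

lemma tight_Un:
  assumes "A \<in> tight" "B \<in> tight" and v: "v \<in> vars A" "v \<in> vars B" "v \<notin> C"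
  shows "A \<union> B \<in> tight"
proof -
  have A: "A \<noteq> {}" "A \<subseteq> L" "card A \<le> s" "surplus S \<kappa> C A \<le> h"
    and B: "B \<subseteq> L" "surplus S \<kappa> C B \<le> h"
    using assms by (auto simp: tight_def)
  have finite: "finite A" "finite B" using A B finite_subset_L by auto
  have "card (A \<union> B) \<le> s"
    using card_Un_le[of A B] double_card_tight_le[OF assms(1)] double_card_tight_le[OF assms(2)]
    by linarith
  moreover have "surplus S \<kappa> C (A \<union> B) \<le> h"
  proof (cases "A \<inter> B = {}")
    case True
    have "0 < card (vars A \<inter> vars B - C)" "0 < card (vars A \<inter> vars B)"
      using v finite_vars[OF finite(1)] by (fastforce simp: card_gt_0_iff simp del: UN_simps)+
    thus ?thesis using surplus_Un_disjoint[OF finite True, of \<kappa> C] A B h_le_2 by linarith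
  next
    case False
    have "card (A \<inter> B) \<le> s" using A(3) card_mono[OF finite(1), of "A \<inter> B"] by simp
    hence "h \<le> surplus S \<kappa> C (A \<inter> B)" using False A by (intro surplus_ge(1)) auto
    thus ?thesis using surplus_submodular[OF finite, of \<kappa> C] A B by linarith
  qed
  ultimately show ?thesis using A B by (auto simp: tight_def)
qed

lemma
  assumes A: "A \<in> tight" and v: "v \<in> vars A" "v \<notin> C"
  shows cluster_tight: "cluster v \<in> tight" and tight_subset_cluster: "A \<subseteq> cluster v"
proof -
  let ?F = "{B \<in> tight. v \<in> vars B}"
  have "finite ?F"
    by (rule finite_subset[of _ "Pow L"]) (auto simp: finite_L dest: tight_subset)
  moreover have "\<Union>F \<in> tight \<and> v \<in> vars (\<Union>F)" if "finite F" "F \<noteq> {}" "F \<subseteq> ?F" for F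
    using that
  proof (induction F rule: finite_ne_induct)
    case (insert B F)
    hence "B \<union> \<Union>F \<in> tight" using v by (intro tight_Un[of _ _ v]) auto
    thus ?case using insert by auto
  qed auto
  moreover have "?F \<noteq> {}" using A v by blast
  ultimately show "cluster v \<in> tight" unfolding cluster_def by blast
  show "A \<subseteq> cluster v" using A v by (auto simp: cluster_def)
qed

lemma cluster_cases:
  assumes "v \<notin> C"
  obtains "cluster v = {}" | "cluster v \<in> tight" "v \<in> vars (cluster v)"
proof (cases "\<exists>A\<in>tight. v \<in> vars A")
  case True
  then obtain A where A: "A \<in> tight" "v \<in> vars A" by blast
  have "vars A \<subseteq> vars (cluster v)" using tight_subset_cluster[OF A assms] by blast
  thus ?thesis using that(2) cluster_tight[OF A assms] A(2) by blast
next
  case False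
  hence "cluster v = {}" unfolding cluster_def by blast
  thus ?thesis by (rule that(1))
qed

lemma cluster_subset: "cluster v \<subseteq> L"
  by (auto simp: cluster_def dest: tight_subset)

lemma finite_cluster: "finite (cluster v)"
  using cluster_subset finite_subset_L by blast

lemma card_cluster_le:
  assumes "v \<notin> C" "0 \<le> h + a"
  shows "card (cluster v) \<le> s" "d * card (cluster v) \<le> h + a"
proof -
  have "card (cluster v) \<le> s \<and> d * card (cluster v) \<le> h + a"
    using assms(1)
  proof (cases rule: cluster_cases)
    case 2
    thus ?thesis using card_tight_le[OF 2(1)] by (simp add: tight_def)
  qed (use assms(2) in simp)
  thus "card (cluster v) \<le> s" "d * card (cluster v) \<le> h + a" by auto
qed

lemma cluster_eq:
  assumes "v \<notin> C" and w: "w \<in> vars (cluster v)" "w \<notin> C"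
  shows "cluster w = cluster v"
proof -
  have tight: "cluster v \<in> tight" "v \<in> vars (cluster v)"
    using w cluster_cases[OF assms(1)] by auto
  have sub: "cluster v \<subseteq> cluster w" by (rule tight_subset_cluster[OF tight(1) w])
  hence "v \<in> vars (cluster w)" using tight(2) by blast
  hence "cluster w \<subseteq> cluster v"
    using tight_subset_cluster[OF cluster_tight[OF tight(1) w]] assms(1) by blast
  with sub show ?thesis by blast
qed

lemma surplus_cluster_Un_le:
  assumes "2 \<le> h" "v \<notin> C" and A: "A \<subseteq> L" "A \<inter> cluster v = {}"
  defines "X \<equiv> insert v (vars (cluster v)) - C"
  shows "surplus S \<kappa> C (cluster v \<union> A) \<le> h + surplus S \<kappa> C A - 2 * int (card (vars A \<inter> X))"
  using assms(2)
proof (cases rule: cluster_cases)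
  case 1
  have "card (vars A \<inter> X) \<le> card {v}" using 1 by (intro card_mono) (auto simp: X_def)
  thus ?thesis using 1 assms(1) by simp
next
  case 2
  let ?Y = "vars (cluster v) \<inter> vars A"
  have "vars A \<inter> X = ?Y - C" using 2(2) by (auto simp: X_def)
  moreover have "card (?Y - C) \<le> card ?Y"
    using finite_vars[OF finite_cluster] by (intro card_mono) auto
  moreover have "surplus S \<kappa> C (cluster v \<union> A) =
      surplus S \<kappa> C (cluster v) + surplus S \<kappa> C A - int (card ?Y) - int (card (?Y - C))"
    using finite_cluster finite_subset_L[OF A(1)] A(2) by (intro surplus_Un_disjoint) auto
  ultimately show ?thesis using 2(1) by (simp add: tight_def)
qed

text \<open>
  If conditioning on a cluster and its unfixed variables lowers the surplus of \<open>A\<close>, then the union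
  of the cluster and \<open>A\<close> has surplus at least \<open>h + 1\<close>, as otherwise \<open>A\<close> would belong to the cluster.
  The cluster costs \<open>h\<close> units of slack and brings in the slack of its own constraints.
\<close>

lemma expanding_after_conditioning:
  assumes "2 \<le> h" "0 \<le> h + a" and v: "v \<notin> C"
  defines "X \<equiv> insert v (vars (cluster v)) - C"
  shows "expanding S \<kappa> (C \<union> X) (L - cluster v) (s - card (cluster v))
    (\<lambda>j. max h (d * j - (a + h - d * card (cluster v))))"
  unfolding expanding_def
proof (intro allI impI, elim conjE)
  fix A assume A: "A \<subseteq> L - cluster v" "A \<noteq> {}" "card A \<le> s - card (cluster v)"
  define E where "E = cluster v"
  have AL: "A \<subseteq> L" "A \<inter> E = {}" "card A \<le> s" using A by (auto simp: E_def)
  have finite: "finite A" "finite E"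
    using AL(1) finite_subset_L finite_cluster by (auto simp: E_def)
  have EA: "E \<union> A \<subseteq> L" "E \<union> A \<noteq> {}" using A cluster_subset by (auto simp: E_def)
  have card_EA: "card (E \<union> A) = card E + card A"
    using finite AL(2) by (intro card_Un_disjoint) auto
  moreover have "card E \<le> s" using card_cluster_le(1)[OF v assms(2)] by (simp add: E_def)
  ultimately have card_EA_le: "card (E \<union> A) \<le> s" using A(3) by (simp add: E_def)
  have surplus_X: "surplus S \<kappa> (C \<union> X) A = surplus S \<kappa> C A - int (card (vars A \<inter> X))"
    using surplus_Un_fixed[OF finite(1), of \<kappa> C X] by (simp add: X_def Int_Diff)
  have surplus_EA: "surplus S \<kappa> C (E \<union> A) \<le> h + surplus S \<kappa> C A - 2 * int (card (vars A \<inter> X))"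
    unfolding E_def X_def using AL v assms(1) by (intro surplus_cluster_Un_le) (auto simp: E_def)
  have "h \<le> surplus S \<kappa> (C \<union> X) A"
  proof (cases "vars A \<inter> X = {}")
    case True
    thus ?thesis using surplus_X surplus_ge(1)[OF AL(1) A(2) AL(3)] by simp
  next
    case False
    have "E \<union> A \<notin> tight"
    proof
      assume tight: "E \<union> A \<in> tight"
      have "v \<in> vars (E \<union> A)"
        using v False unfolding E_def X_def by (cases rule: cluster_cases) auto
      from tight_subset_cluster[OF tight this v] show False using A AL(2) by (auto simp: E_def)
    qed
    hence "h + 1 \<le> surplus S \<kappa> C (E \<union> A)" unfolding tight_def using EA card_EA_le by fastforce
    moreover have "1 \<le> card (vars A \<inter> X)"
      using False finite_vars[OF finite(1)] by (simp add: Suc_le_eq card_gt_0_iff)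
    ultimately show ?thesis using surplus_X surplus_EA h_le_2 by linarith
  qed
  moreover have "d * (card E + card A) - a \<le> surplus S \<kappa> C (E \<union> A)"
    using surplus_ge(2)[OF EA card_EA_le] card_EA by simp
  hence "d * (card E + card A) - a \<le> surplus S \<kappa> (C \<union> X) A + h"
    using surplus_X surplus_EA by linarith
  ultimately show "max h (d * card A - (a + h - d * card (cluster v))) \<le> surplus S \<kappa> (C \<union> X) A"
    by (simp add: E_def algebra_simps)
qed

lemma tight_cover:
  assumes "0 \<le> h" "finite X" "X \<subseteq> vars (\<Union>tight)"
  shows "\<exists>U\<subseteq>\<Union>tight. X \<subseteq> vars U \<and> surplus S \<kappa> C U \<le> h * card X \<and> d * card U \<le> (h + a) * card X"
  using assms(2,3)
proof (induction X rule: finite_induct)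
  case empty
  show ?case by (intro exI[of _ "{}"]) auto
next
  case (insert v X)
  then obtain U where U: "U \<subseteq> \<Union>tight" "X \<subseteq> vars U" "surplus S \<kappa> C U \<le> h * card X"
      "d * card U \<le> (h + a) * card X"
    by auto
  obtain A where A: "A \<in> tight" "v \<in> vars A" using insert.prems by auto
  have AL: "A \<subseteq> L" "card A \<le> s" "surplus S \<kappa> C A \<le> h" using A(1) by (auto simp: tight_def)
  have "U \<subseteq> L" using U(1) tight_subset by blast
  hence finite: "finite U" "finite A" using AL(1) finite_subset_L by blast+
  have "card (U \<inter> A) \<le> s" using card_mono[OF finite(2), of "U \<inter> A"] AL(2) by simp
  hence "0 \<le> surplus S \<kappa> C (U \<inter> A)"
    using surplus_ge(1)[of "U \<inter> A"] AL(1) assms(1) by (cases "U \<inter> A = {}") (force, fastforce)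
  hence "surplus S \<kappa> C (U \<union> A) \<le> h * card (insert v X)"
    using surplus_submodular[OF finite, of \<kappa> C] U(3) AL(3) insert.hyps
    by (simp add: algebra_simps)
  moreover have "d * card (U \<union> A) \<le> (h + a) * card (insert v X)"
  proof -
    have "d * card (U \<union> A) \<le> d * (card U + card A)" using card_Un_le[of U A] d_pos by simp
    thus ?thesis using U(4) card_tight_le[OF A(1)] insert.hyps by (simp add: algebra_simps)
  qed
  ultimately show ?case using U A by (intro exI[of _ "U \<union> A"]) auto
qed

text \<open>
  Every variable that is fixed with the tight sets is paid for by a tight set of surplus at most 1,
  and fixing it subtracts exactly 1 from the surplus of a set containing it.
\<close>

lemma surplus_after_closure_ge:
  assumes h: "0 \<le> h" "h \<le> 1" and E: "E \<subseteq> L - \<Union>tight"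
  shows "\<exists>U\<subseteq>\<Union>tight. surplus S \<kappa> C (E \<union> U) \<le> surplus S \<kappa> (C \<union> vars (\<Union>tight)) E \<and>
    d * card U \<le> (h + a) * card (vars E \<inter> vars (\<Union>tight) - C)"
proof -
  define X where "X = vars E \<inter> vars (\<Union>tight) - C"
  have finite_E: "finite E" using E finite_subset_L by blast
  have "finite X" "X \<subseteq> vars (\<Union>tight)" using finite_vars[OF finite_E] by (auto simp: X_def)
  then obtain U where U: "U \<subseteq> \<Union>tight" "X \<subseteq> vars U" "surplus S \<kappa> C U \<le> h * card X"
      "d * card U \<le> (h + a) * card X"
    using tight_cover[OF h(1)] by blast
  have "U \<subseteq> L" "E \<inter> U = {}" using E U(1) by (auto dest: tight_subset)
  hence "surplus S \<kappa> C (E \<union> U) = surplus S \<kappa> C E + surplus S \<kappa> C U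
      - int (card (vars E \<inter> vars U)) - int (card (vars E \<inter> vars U - C))"
    using finite_E finite_subset_L by (intro surplus_Un_disjoint)
  moreover have "vars E \<inter> vars U - C = X" using U(1,2) unfolding X_def by blast
  moreover have "card (vars E \<inter> vars U - C) \<le> card (vars E \<inter> vars U)"
    using finite_vars[OF finite_E] by (intro card_mono) auto
  moreover have "h * card X \<le> card X" using h by (simp add: mult_left_le_one_le)
  ultimately have "surplus S \<kappa> C (E \<union> U) \<le> surplus S \<kappa> C E - card X" using U(3) by simp
  also have "\<dots> = surplus S \<kappa> (C \<union> vars (\<Union>tight)) E"
    using surplus_Un_fixed[OF finite_E] by (simp add: X_def)
  finally show ?thesis using U(1,4) unfolding X_def by blast
qed

lemma expanding_after_closure:
  assumes h: "0 \<le> h" "h \<le> 1" "0 \<le> h + a" and card_scope: "\<And>e. card (S e) \<le> k"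
    and s': "s' * (1 + (h + a) * k / d) \<le> s"
  defines "D \<equiv> \<Union>tight"
  shows "expanding S \<kappa> (C \<union> vars D) (L - D) s' (\<lambda>j. max (h + 1) (d * j - a))"
  unfolding expanding_def
proof (intro allI impI, elim conjE)
  fix E assume E: "E \<subseteq> L - D" "E \<noteq> {}" "card E \<le> s'"
  obtain U where U: "U \<subseteq> D" "surplus S \<kappa> C (E \<union> U) \<le> surplus S \<kappa> (C \<union> vars D) E"
      "d * card U \<le> (h + a) * card (vars E \<inter> vars D - C)"
    using surplus_after_closure_ge[OF h(1,2)] E(1) unfolding D_def by blast
  have EU: "E \<union> U \<subseteq> L" "E \<inter> U = {}" using E U(1) by (auto simp: D_def dest: tight_subset)
  hence finite: "finite E" "finite U" using finite_subset_L by blast+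
  have card_EU: "card (E \<union> U) \<le> s"
  proof -
    have "card (vars E \<inter> vars D - C) \<le> card (vars E)"
      using finite_vars[OF finite(1)] by (intro card_mono) auto
    also have "\<dots> \<le> (\<Sum>e\<in>E. card (S e))" using finite(1) by (rule card_UN_le)
    also have "\<dots> \<le> card E * k" using sum_bounded_above[of E "\<lambda>e. card (S e)" k] card_scope by simp
    finally have "(h + a) * card (vars E \<inter> vars D - C) \<le> (h + a) * real (card E * k)"
      using h(3) by (intro mult_left_mono of_nat_mono)
    hence "card U \<le> card E * ((h + a) * k / d)"
      using U(3) d_pos by (simp add: field_simps)
    hence "card (E \<union> U) \<le> card E * (1 + (h + a) * k / d)"
      using card_Un_disjoint[OF finite EU(2)] by (simp add: distrib_left)
    also have "\<dots> \<le> s' * (1 + (h + a) * k / d)"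
      using E(3) d_pos h(3) by (intro mult_right_mono) auto
    finally show ?thesis using s' by simp
  qed
  moreover have "E \<union> U \<notin> tight" using E by (auto simp: D_def)
  ultimately have "h + 1 \<le> surplus S \<kappa> C (E \<union> U)"
    using EU(1) E(2) by (simp add: tight_def)
  moreover have "d * card E \<le> d * card (E \<union> U)"
    using d_pos finite by (intro mult_left_mono of_nat_mono card_mono) auto
  hence "d * card E - a \<le> surplus S \<kappa> C (E \<union> U)"
    using surplus_ge(2)[OF EU(1) _ card_EU] E(2) by simp
  ultimately show "max (h + 1) (d * card E - a) \<le> surplus S \<kappa> (C \<union> vars D) E" using U(2) by simp
qed

end

section \<open>Local distributions\<close>

definition reassignments :: "'v set \<Rightarrow> ('v \<Rightarrow> 'a) \<Rightarrow> ('v \<Rightarrow> 'a) set" where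
  "reassignments W \<rho> = {z. \<forall>v. v \<notin> W \<longrightarrow> z v = \<rho> v}"

lemma reassignments_outside: "z \<in> reassignments W \<rho> \<Longrightarrow> v \<notin> W \<Longrightarrow> z v = \<rho> v"
  by (simp add: reassignments_def)

lemma reassignments_empty [simp]: "reassignments {} \<rho> = {\<rho>}"
  by (auto simp: reassignments_def)

lemma bij_betw_reassignments: "bij_betw (\<lambda>z. restrict z W) (reassignments W \<rho>) (W \<rightarrow>\<^sub>E UNIV)"
  by (rule bij_betw_byWitness[where f' = "\<lambda>z. override_on \<rho> z W"])
    (auto simp: reassignments_def override_on_def fun_eq_iff PiE_iff extensional_def)

lemma finite_reassignments [simp]:
  fixes \<rho> :: "'v \<Rightarrow> 'a::finite"
  shows "finite W \<Longrightarrow> finite (reassignments W \<rho>)"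
  using bij_betw_finite[OF bij_betw_reassignments[of W \<rho>]] by (simp add: finite_PiE)

lemma card_reassignments:
  fixes \<rho> :: "'v \<Rightarrow> 'a::finite"
  shows "finite W \<Longrightarrow> card (reassignments W \<rho>) = CARD('a) ^ card W"
  using bij_betw_same_card[OF bij_betw_reassignments[of W \<rho>]] by (simp add: card_funcsetE)

lemma sum_reassignments_singleton:
  fixes \<rho> :: "'v \<Rightarrow> 'a::finite"
  shows "(\<Sum>z\<in>reassignments {v} \<rho>. f (z v)) = (\<Sum>a\<in>UNIV. f a)"
  by (rule sum.reindex_bij_witness[where i = "\<lambda>a. \<rho>(v := a)" and j = "\<lambda>z. z v"])
    (auto simp: reassignments_def)

lemma sum_reassignments_split:
  fixes \<rho> :: "'v \<Rightarrow> 'a::finite"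
  assumes "finite W" "Q \<subseteq> W"
  shows "(\<Sum>z\<in>reassignments W \<rho>. f z) =
    (\<Sum>y\<in>reassignments (W - Q) \<rho>. \<Sum>z\<in>reassignments Q y. f z)"
proof -
  let ?reset = "\<lambda>z. override_on z \<rho> Q"
  have "(\<Sum>z\<in>reassignments W \<rho>. f z) =
      (\<Sum>y\<in>reassignments (W - Q) \<rho>. sum f {z \<in> reassignments W \<rho>. ?reset z = y})"
    using assms
    by (intro sum.group[symmetric] finite_reassignments)
      (auto simp: reassignments_def override_on_def)
  moreover have "{z \<in> reassignments W \<rho>. ?reset z = y} = reassignments Q y"
    if "y \<in> reassignments (W - Q) \<rho>" for y
    using that assms(2) by (fastforce simp: reassignments_def override_on_def fun_eq_iff)
  ultimately show ?thesis by simp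
qed

definition wise_uniform :: "nat \<Rightarrow> ('k::finite \<Rightarrow> bool) pmf \<Rightarrow> bool" where
  "wise_uniform s \<mu> \<longleftrightarrow> (\<forall>T \<alpha>. 1 \<le> card T \<and> card T \<le> s \<longrightarrow>
     measure_pmf.prob \<mu> {z. \<forall>i\<in>T. z i = \<alpha> i} = (1 / 2) ^ card T)"

lemma sum_pmf_reassignments:
  fixes \<mu> :: "('k::finite \<Rightarrow> bool) pmf"
  assumes "wise_uniform s \<mu>" "card (- U) \<le> s"
  shows "2 ^ CARD('k) * (\<Sum>a\<in>reassignments U \<alpha>. pmf \<mu> a) = 2 ^ card U"
proof -
  have reassignments_eq: "reassignments U \<alpha> = {a. \<forall>i\<in>- U. a i = \<alpha> i}"
    by (auto simp: reassignments_def)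
  have "(\<Sum>a\<in>reassignments U \<alpha>. pmf \<mu> a) = measure_pmf.prob \<mu> (reassignments U \<alpha>)"
    by (simp add: measure_measure_pmf_finite)
  also have "\<dots> = (1 / 2) ^ card (- U)"
    using assms unfolding reassignments_eq wise_uniform_def
    by (cases "- U = {}") (auto simp: Suc_le_eq card_gt_0_iff)
  finally have "(\<Sum>a\<in>reassignments U \<alpha>. pmf \<mu> a) = (1 / 2) ^ card (- U)" .
  moreover have "CARD('k) = card U + card (- U)"
    using card_mono[of UNIV U] by (simp add: Compl_eq_Diff_UNIV card_Diff_subset)
  ultimately show ?thesis by (simp add: power_add power_one_over)
qed

definition constraint_input :: "'k constraint \<Rightarrow> (nat \<Rightarrow> bool) \<Rightarrow> 'k \<Rightarrow> bool" where
  "constraint_input e z = (\<lambda>q. z (snd e q) \<noteq> fst e q)"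

lemma sum_pmf_constraint_input:
  fixes \<mu> :: "('k::finite \<Rightarrow> bool) pmf"
  assumes "wise_uniform s \<mu>" "card (- U) \<le> s"
    and inj: "inj_on (snd e) U" and sep: "\<And>q. q \<notin> U \<Longrightarrow> snd e q \<notin> snd e ` U"
  shows "2 ^ CARD('k) * (\<Sum>z\<in>reassignments (snd e ` U) y. pmf \<mu> (constraint_input e z)) =
    2 ^ card U"
proof -
  let ?S = "snd e"
  let ?inverse = "\<lambda>a v. if v \<in> ?S ` U then a (inv_into U ?S v) \<noteq> fst e (inv_into U ?S v) else y v"
  have "(\<Sum>z\<in>reassignments (?S ` U) y. pmf \<mu> (constraint_input e z)) =
      (\<Sum>a\<in>reassignments U (constraint_input e y). pmf \<mu> a)"
  proof (rule sum.reindex_bij_witness[where j = "constraint_input e" and i = ?inverse])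
    fix z assume z: "z \<in> reassignments (?S ` U) y"
    show "?inverse (constraint_input e z) = z"
      using z inj by (auto simp: fun_eq_iff reassignments_def constraint_input_def)
    show "constraint_input e z \<in> reassignments U (constraint_input e y)"
      using z sep by (auto simp: reassignments_def constraint_input_def)
  next
    fix a assume a: "a \<in> reassignments U (constraint_input e y)"
    show "constraint_input e (?inverse a) = a"
    proof
      show "constraint_input e (?inverse a) q = a q" for q
        using reassignments_outside[OF a] sep[of q] inj
        by (cases "q \<in> U"; cases "fst e q") (simp_all add: constraint_input_def)
    qed
    show "?inverse a \<in> reassignments (?S ` U) y" by (auto simp: reassignments_def)
  qed simp
  thus ?thesis using sum_pmf_reassignments[OF assms(1,2)] by simp
qed

definition scope :: "('e \<Rightarrow> 'k::finite constraint) \<Rightarrow> 'e \<Rightarrow> nat set" where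
  "scope cs e = range (snd (cs e))"

lemma scope_family_scope: "scope_family (scope cs)"
  by unfold_locales (simp add: scope_def)

lemma card_scope_le: "card (scope (cs :: 'e \<Rightarrow> 'k::finite constraint) e) \<le> CARD('k)"
  unfolding scope_def by (rule card_image_le) simp

abbreviation csp_surplus ::
  "('e \<Rightarrow> 'k::finite constraint) \<Rightarrow> nat \<Rightarrow> nat set \<Rightarrow> 'e set \<Rightarrow> int" where
  "csp_surplus cs t \<equiv> surplus (scope cs) (2 * int CARD('k) - int t)"

abbreviation csp_expanding ::
  "('e \<Rightarrow> 'k::finite constraint) \<Rightarrow> nat \<Rightarrow> nat set \<Rightarrow> 'e set \<Rightarrow> nat \<Rightarrow> (nat \<Rightarrow> real) \<Rightarrow> bool" where
  "csp_expanding cs t \<equiv> expanding (scope cs) (2 * int CARD('k) - int t)"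

definition private_positions ::
  "('e \<Rightarrow> 'k::finite constraint) \<Rightarrow> nat set \<Rightarrow> 'e set \<Rightarrow> 'e \<Rightarrow> 'k set" where
  "private_positions cs C E e = {q. snd (cs e) q \<notin> C \<and>
     (\<forall>e'\<in>E. \<forall>q'. snd (cs e') q' = snd (cs e) q \<longrightarrow> e' = e \<and> q' = q)}"

text \<open>
  A value outside \<open>C\<close> with a single preimage is counted by the last set, and every other one has a
  second preimage.
\<close>

lemma card_image_add_card_image_Diff_le:
  assumes "finite A"
  shows "card (f ` A) + card (f ` A - C) \<le>
    card A + card {p \<in> A. f p \<notin> C \<and> (\<forall>p'\<in>A. f p' = f p \<longrightarrow> p' = p)}"
proof -
  define R where "R = inv_into A f ` f ` A"
  define U where "U = {p \<in> A. f p \<notin> C \<and> (\<forall>p'\<in>A. f p' = f p \<longrightarrow> p' = p)}"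
  have R: "R \<subseteq> A" "card R = card (f ` A)"
    by (auto simp: R_def inv_into_into card_image inj_on_inv_into)
  have "f ` A - C \<subseteq> f ` (A - R) \<union> f ` U"
  proof
    fix v assume v: "v \<in> f ` A - C"
    show "v \<in> f ` (A - R) \<union> f ` U"
    proof (cases "v \<in> f ` (A - R)")
      case False
      define p where "p = inv_into A f v"
      have p: "p \<in> A" "f p = v" using v by (auto simp: p_def inv_into_into f_inv_into_f)
      have unique: "p' = p" if "p' \<in> A" "f p' = v" for p'
      proof -
        have "p' \<in> R" using that False by blast
        then obtain u where "u \<in> f ` A" "p' = inv_into A f u" unfolding R_def by blast
        thus ?thesis using that(2) by (simp add: p_def f_inv_into_f)
      qed
      have "p \<in> U" unfolding U_def using v p unique by blast
      thus ?thesis using p(2) by blast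
    qed simp
  qed
  hence "card (f ` A - C) \<le> card (f ` (A - R) \<union> f ` U)"
    using assms by (intro card_mono) (auto simp: U_def)
  also have "\<dots> \<le> card (f ` (A - R)) + card (f ` U)" by (rule card_Un_le)
  also have "\<dots> \<le> card (A - R) + card U"
    using assms by (intro add_mono card_image_le) (auto simp: U_def)
  finally show ?thesis
    using R assms card_mono[of A R] by (simp add: U_def card_Diff_subset finite_subset)
qed

lemma exists_constraint_few_shared_positions:
  fixes cs :: "'e \<Rightarrow> 'k::finite constraint"
  assumes "finite E" and pos: "0 < csp_surplus cs t C E"
  shows "\<exists>e\<in>E. card (- private_positions cs C E e) < t"
proof (rule ccontr)
  assume "\<not> ?thesis"
  hence many: "t \<le> card (- private_positions cs C E e)" if "e \<in> E" for e
    using that by (simp add: not_less)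
  define f where "f = (\<lambda>(e, q). snd (cs e) q)"
  let ?V = "\<Union>(scope cs ` E)"
  let ?U = "Sigma E (private_positions cs C E)"
  have V: "f ` (E \<times> UNIV) = ?V" by (auto simp: f_def scope_def)
  have U: "{p \<in> E \<times> UNIV. f p \<notin> C \<and> (\<forall>p'\<in>E \<times> UNIV. f p' = f p \<longrightarrow> p' = p)} = ?U"
    by (auto simp: f_def private_positions_def)
  have "card ?V + card (?V - C) \<le> CARD('k) * card E + card ?U"
    using card_image_add_card_image_Diff_le[of "E \<times> UNIV" f C] assms(1)
    unfolding V U by (simp add: card_cartesian_product mult.commute)
  moreover have "card ?U + t * card E \<le> CARD('k) * card E"
  proof -
    have "card (private_positions cs C E e) + t \<le> CARD('k)" if "e \<in> E" for e
      using many[OF that] card_mono[of UNIV "private_positions cs C E e"]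
      by (simp add: Compl_eq_Diff_UNIV card_Diff_subset)
    hence "(\<Sum>e\<in>E. card (private_positions cs C E e) + t) \<le> (\<Sum>e\<in>E. CARD('k))"
      by (rule sum_mono)
    thus ?thesis using assms(1) by (simp add: sum.distrib mult.commute)
  qed
  ultimately have "int (card ?V + card (?V - C) + t * card E) \<le> int (2 * (CARD('k) * card E))"
    by (intro of_nat_mono) linarith
  thus False using pos by (simp add: surplus_def algebra_simps)
qed

text \<open>The factor makes this a product of densities relative to the uniform distribution.\<close>

definition local_weight ::
  "('k::finite \<Rightarrow> bool) pmf \<Rightarrow> ('e \<Rightarrow> 'k constraint) \<Rightarrow> 'e set \<Rightarrow> (nat \<Rightarrow> bool) \<Rightarrow> real" where
  "local_weight \<mu> cs E z = (\<Prod>e\<in>E. 2 ^ CARD('k) * pmf \<mu> (constraint_input (cs e) z))"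

lemma local_weight_nonneg: "0 \<le> local_weight \<mu> cs E z"
  by (simp add: local_weight_def prod_nonneg)

lemma constraint_input_cong:
  "(\<And>v. v \<in> scope cs e \<Longrightarrow> z v = y v) \<Longrightarrow> constraint_input (cs e) z = constraint_input (cs e) y"
  by (simp add: constraint_input_def scope_def)

lemma local_weight_cong:
  assumes "\<And>e v. e \<in> E \<Longrightarrow> v \<in> scope cs e \<Longrightarrow> z v = y v"
  shows "local_weight \<mu> cs E z = local_weight \<mu> cs E y"
proof -
  have "constraint_input (cs e) z = constraint_input (cs e) y" if "e \<in> E" for e
    by (rule constraint_input_cong) (rule assms[OF that])
  thus ?thesis by (simp add: local_weight_def)
qed

lemma constraint_input_in_set_pmf:
  assumes "0 < local_weight \<mu> cs E z" "finite E" "e \<in> E"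
  shows "constraint_input (cs e) z \<in> set_pmf \<mu>"
proof (rule ccontr)
  assume "constraint_input (cs e) z \<notin> set_pmf \<mu>"
  hence "local_weight \<mu> cs E z = 0"
    unfolding local_weight_def using assms(2,3) by (intro prod_zero) (auto simp: set_pmf_iff)
  thus False using assms(1) by simp
qed

lemma sum_local_weight_remove:
  fixes \<mu> :: "('k::finite \<Rightarrow> bool) pmf" and cs :: "'e \<Rightarrow> 'k constraint"
  assumes "wise_uniform s \<mu>" "finite E" "finite W" and e: "e \<in> E"
    and shared: "card (- private_positions cs C E e) \<le> s"
  defines "Q \<equiv> snd (cs e) ` private_positions cs C E e"
  assumes "Q \<subseteq> W"
  shows "(\<Sum>z\<in>reassignments W \<rho>. local_weight \<mu> cs E z) =
    2 ^ card Q * (\<Sum>y\<in>reassignments (W - Q) \<rho>. local_weight \<mu> cs (E - {e}) y)"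
proof -
  let ?U = "private_positions cs C E e"
  have inj: "inj_on (snd (cs e)) ?U" using e by (auto simp: inj_on_def private_positions_def)
  have sep: "snd (cs e) q \<notin> snd (cs e) ` ?U" if "q \<notin> ?U" for q
  proof
    assume "snd (cs e) q \<in> snd (cs e) ` ?U"
    then obtain q' where "q' \<in> ?U" "snd (cs e) q = snd (cs e) q'" by blast
    thus False using e that by (auto simp: private_positions_def)
  qed
  have disjoint: "\<Union>(scope cs ` (E - {e})) \<inter> Q = {}"
    by (auto simp: Q_def scope_def private_positions_def)
  have const: "local_weight \<mu> cs (E - {e}) z = local_weight \<mu> cs (E - {e}) y"
    if "z \<in> reassignments Q y" for z y
    using disjoint reassignments_outside[OF that] by (intro local_weight_cong) blast
  have "(\<Sum>z\<in>reassignments W \<rho>. local_weight \<mu> cs E z) =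
      (\<Sum>z\<in>reassignments W \<rho>. local_weight \<mu> cs (E - {e}) z *
        (2 ^ CARD('k) * pmf \<mu> (constraint_input (cs e) z)))"
    using \<open>finite E\<close> e by (simp add: local_weight_def prod.remove mult.commute)
  also have "\<dots> = (\<Sum>y\<in>reassignments (W - Q) \<rho>. \<Sum>z\<in>reassignments Q y.
      local_weight \<mu> cs (E - {e}) z * (2 ^ CARD('k) * pmf \<mu> (constraint_input (cs e) z)))"
    by (rule sum_reassignments_split) fact+
  also have "\<dots> = (\<Sum>y\<in>reassignments (W - Q) \<rho>. local_weight \<mu> cs (E - {e}) y *
      (2 ^ CARD('k) * (\<Sum>z\<in>reassignments Q y. pmf \<mu> (constraint_input (cs e) z))))"
    using const by (simp add: sum_distrib_left)
  also have "\<dots> = (\<Sum>y\<in>reassignments (W - Q) \<rho>. local_weight \<mu> cs (E - {e}) y * 2 ^ card Q)"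
    unfolding Q_def using sum_pmf_constraint_input[OF \<open>wise_uniform s \<mu>\<close> shared inj sep]
    by (simp add: card_image[OF inj])
  finally show ?thesis by (simp add: mult.commute flip: sum_distrib_left)
qed

lemma sum_local_weight:
  fixes \<mu> :: "('k::finite \<Rightarrow> bool) pmf" and cs :: "'e \<Rightarrow> 'k constraint"
  assumes uniform: "wise_uniform (t - 1) \<mu>"
    and "finite E" "finite W" "\<Union>(scope cs ` E) \<subseteq> W \<union> C" "W \<inter> C = {}"
    and "\<And>A. A \<subseteq> E \<Longrightarrow> A \<noteq> {} \<Longrightarrow> 0 < csp_surplus cs t C A"
  shows "(\<Sum>z\<in>reassignments W \<rho>. local_weight \<mu> cs E z) = 2 ^ card W"
  using assms(2-)
proof (induction "card E" arbitrary: E W C)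
  case 0
  thus ?case by (simp add: local_weight_def card_reassignments)
next
  case (Suc N)
  interpret scope_family "scope cs" by (rule scope_family_scope)
  have "E \<noteq> {}" using Suc.hyps(2) by auto
  then obtain e where e: "e \<in> E" "card (- private_positions cs C E e) < t"
    using exists_constraint_few_shared_positions[of E cs t C] Suc.prems by blast
  let ?Q = "snd (cs e) ` private_positions cs C E e" and ?E = "E - {e}"
  have Q: "?Q \<subseteq> W" using Suc.prems(3) e(1) by (fastforce simp: private_positions_def scope_def)
  have disjoint: "vars ?E \<inter> ?Q = {}" by (auto simp: scope_def private_positions_def)
  have "0 < csp_surplus cs t (C \<union> ?Q) A" if A: "A \<subseteq> ?E" "A \<noteq> {}" for A
  proof -
    have "vars A \<inter> ?Q = {}" using disjoint A(1) by blast
    moreover have "finite A" using A(1) Suc.prems(1) by (meson finite_Diff finite_subset)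
    ultimately show ?thesis using Suc.prems(5)[of A] A by (subst surplus_Un_fixed) auto
  qed
  hence "(\<Sum>y\<in>reassignments (W - ?Q) \<rho>. local_weight \<mu> cs ?E y) = 2 ^ card (W - ?Q)"
    using Suc.prems Suc.hyps(2) e(1) by (intro Suc.hyps(1)[of _ _ "C \<union> ?Q"]) auto
  moreover have "(\<Sum>z\<in>reassignments W \<rho>. local_weight \<mu> cs E z) =
      2 ^ card ?Q * (\<Sum>y\<in>reassignments (W - ?Q) \<rho>. local_weight \<mu> cs ?E y)"
    using e Suc.prems(1,2) Q by (intro sum_local_weight_remove[OF uniform]) auto
  moreover have "card W = card ?Q + card (W - ?Q)"
    using Q Suc.prems(2) card_mono[OF Suc.prems(2) Q]
    by (simp add: card_Diff_subset finite_subset)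
  ultimately show ?case by (simp add: power_add)
qed

text \<open>Fixing one more variable lowers every surplus by at most 1.\<close>

lemma sum_local_weight_mult_of_bool:
  fixes \<mu> :: "('k::finite \<Rightarrow> bool) pmf" and cs :: "'e \<Rightarrow> 'k constraint"
  assumes uniform: "wise_uniform (t - 1) \<mu>"
    and finite: "finite E" "finite W" and W: "\<Union>(scope cs ` E) \<subseteq> W \<union> C" "W \<inter> C = {}"
    and surplus_ge: "\<And>A. A \<subseteq> E \<Longrightarrow> A \<noteq> {} \<Longrightarrow> 2 \<le> csp_surplus cs t C A" and j: "j \<in> W"
  shows "(\<Sum>z\<in>reassignments W \<rho>. local_weight \<mu> cs E z * of_bool (z j)) = 2 ^ card W / 2"
proof -
  interpret scope_family "scope cs" by (rule scope_family_scope)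
  let ?W = "W - {j}"
  have "0 < csp_surplus cs t (C \<union> {j}) A" if "A \<subseteq> E" "A \<noteq> {}" for A
  proof -
    have "card (vars A \<inter> {j} - C) \<le> card {j}" by (intro card_mono) auto
    moreover have "finite A" using that finite(1) finite_subset by blast
    ultimately show ?thesis
      using surplus_ge[OF that] surplus_Un_fixed[of A _ C "{j}"] by simp
  qed
  hence inner: "(\<Sum>z\<in>reassignments ?W y. local_weight \<mu> cs E z) = 2 ^ card ?W" for y
    using finite W by (intro sum_local_weight[OF uniform, of _ _ _ "C \<union> {j}"]) auto
  have "W - ?W = {j}" using j by auto
  hence "(\<Sum>z\<in>reassignments W \<rho>. local_weight \<mu> cs E z * of_bool (z j)) =
      (\<Sum>y\<in>reassignments {j} \<rho>. \<Sum>z\<in>reassignments ?W y. local_weight \<mu> cs E z * of_bool (z j))"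
    using finite(2) by (subst sum_reassignments_split[of _ ?W]) auto
  also have "\<dots> = (\<Sum>y\<in>reassignments {j} \<rho>.
      (\<Sum>z\<in>reassignments ?W y. local_weight \<mu> cs E z) * of_bool (y j))"
    unfolding sum_distrib_right
    by (intro sum.cong refl arg_cong2[of _ _ _ _ "(*)"] arg_cong[of _ _ of_bool])
      (auto dest: reassignments_outside[of _ _ _ j])
  also have "\<dots> = 2 ^ card ?W"
    unfolding inner
    using sum_reassignments_singleton[of "\<lambda>b. 2 ^ card ?W * of_bool b :: real" j \<rho>]
    by (simp add: UNIV_bool)
  also have "\<dots> = 2 ^ card W / 2"
    unfolding card_Suc_Diff1[OF finite(2) j, symmetric] by simp
  finally show ?thesis .
qed

section \<open>Convexity and the operator \<open>N\<^sub>+\<close>\<close>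

definition convex_vec :: "nat \<Rightarrow> real vec set \<Rightarrow> bool" where
  "convex_vec n K \<longleftrightarrow> K \<subseteq> carrier_vec n \<and>
     (\<forall>x\<in>K. \<forall>y\<in>K. \<forall>a\<ge>0. \<forall>b\<ge>0. a + b = 1 \<longrightarrow> a \<cdot>\<^sub>v x + b \<cdot>\<^sub>v y \<in> K)"

lemma convex_vecI:
  assumes "K \<subseteq> carrier_vec n"
    and "\<And>x y a b. x \<in> K \<Longrightarrow> y \<in> K \<Longrightarrow> a \<ge> 0 \<Longrightarrow> b \<ge> 0 \<Longrightarrow> a + b = 1 \<Longrightarrow> a \<cdot>\<^sub>v x + b \<cdot>\<^sub>v y \<in> K"
  shows "convex_vec n K"
  using assms by (simp add: convex_vec_def)

lemma convex_vec_carrier: "convex_vec n K \<Longrightarrow> x \<in> K \<Longrightarrow> x \<in> carrier_vec n"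
  by (auto simp: convex_vec_def)

lemma convex_vecD:
  "convex_vec n K \<Longrightarrow> x \<in> K \<Longrightarrow> y \<in> K \<Longrightarrow> a \<ge> 0 \<Longrightarrow> b \<ge> 0 \<Longrightarrow> a + b = 1 \<Longrightarrow>
     a \<cdot>\<^sub>v x + b \<cdot>\<^sub>v y \<in> K"
  by (simp add: convex_vec_def)

lemma literal_convex_combination:
  "a + b = 1 \<Longrightarrow> literal (a * x + b * y) c = a * literal x c + b * literal y c"
  by (auto simp: literal_def right_diff_distrib)

lemma convex_vec_csp_polytope:
  assumes scope: "\<And>c S i. (c, S) \<in># I \<Longrightarrow> S i < n"
  shows "convex_vec n (csp_polytope n P I)"
proof (rule convex_vecI)
  show "csp_polytope n P I \<subseteq> carrier_vec n" by (auto simp: csp_polytope_def)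
  fix x y and a b :: real
  assume x: "x \<in> csp_polytope n P I" and y: "y \<in> csp_polytope n P I"
    and ab: "a \<ge> 0" "b \<ge> 0" "a + b = 1"
  have carrier: "x \<in> carrier_vec n" "y \<in> carrier_vec n" using x y by (auto simp: csp_polytope_def)
  have "1 \<le> (\<Sum>i\<in>UNIV. literal ((a \<cdot>\<^sub>v x + b \<cdot>\<^sub>v y) $ S i) (c i \<noteq> f i))"
    if "(c, S) \<in># I" "\<not> P f" for c S f
  proof -
    have "1 = a * 1 + b * 1" using ab by simp
    also have "\<dots> \<le> a * (\<Sum>i\<in>UNIV. literal (x $ S i) (c i \<noteq> f i)) +
        b * (\<Sum>i\<in>UNIV. literal (y $ S i) (c i \<noteq> f i))"
      using x y that ab unfolding csp_polytope_def by (intro add_mono mult_left_mono) blast+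
    also have "\<dots> = (\<Sum>i\<in>UNIV. literal ((a \<cdot>\<^sub>v x + b \<cdot>\<^sub>v y) $ S i) (c i \<noteq> f i))"
      using carrier scope[OF that(1)] ab(3)
      by (simp add: literal_convex_combination sum.distrib sum_distrib_left)
    finally show ?thesis .
  qed
  thus "a \<cdot>\<^sub>v x + b \<cdot>\<^sub>v y \<in> csp_polytope n P I" using x y by (auto simp: csp_polytope_def)
qed

lemma homog_coneI: "l \<ge> 0 \<Longrightarrow> x \<in> K \<Longrightarrow> vCons l (l \<cdot>\<^sub>v x) \<in> homog_cone K"
  by (auto simp: homog_cone_def)

lemma smult_vCons: "a \<cdot>\<^sub>v vCons l v = vCons (a * l) (a \<cdot>\<^sub>v v)"
  by (rule eq_vecI) (auto simp: vec_index_vCons)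

lemma add_vCons: "dim_vec v = dim_vec w \<Longrightarrow> vCons l v + vCons k w = vCons (l + k) (v + w)"
  by (rule eq_vecI) (auto simp: vec_index_vCons)

lemma homog_cone_smult:
  assumes "v \<in> homog_cone K" "a \<ge> 0"
  shows "a \<cdot>\<^sub>v v \<in> homog_cone K"
proof -
  obtain l x where "l \<ge> 0" "x \<in> K" "v = vCons l (l \<cdot>\<^sub>v x)"
    using assms(1) by (auto simp: homog_cone_def)
  thus ?thesis
    using homog_coneI[of "a * l" x K] assms(2) by (simp add: smult_vCons smult_smult_assoc)
qed

lemma homog_cone_add:
  assumes K: "convex_vec n K" and "v \<in> homog_cone K" "w \<in> homog_cone K"
  shows "v + w \<in> homog_cone K"
proof -
  obtain l x k y where v: "l \<ge> 0" "x \<in> K" "v = vCons l (l \<cdot>\<^sub>v x)"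
    and w: "k \<ge> 0" "y \<in> K" "w = vCons k (k \<cdot>\<^sub>v y)"
    using assms(2,3) by (auto simp: homog_cone_def)
  have carrier: "x \<in> carrier_vec n" "y \<in> carrier_vec n"
    using v(2) w(2) K by (auto dest: convex_vec_carrier)
  show ?thesis
  proof (cases "l + k = 0")
    case True
    hence "l = 0" "k = 0" using v w by auto
    hence "v + w = vCons 0 (0 \<cdot>\<^sub>v x)"
      using v w carrier by (intro eq_vecI) (auto simp: vec_index_vCons)
    thus ?thesis using homog_coneI[of 0 x K] v(2) by simp
  next
    case False
    let ?z = "(l / (l + k)) \<cdot>\<^sub>v x + (k / (l + k)) \<cdot>\<^sub>v y"
    have "?z \<in> K"
      using False v w by (intro convex_vecD[OF K]) (auto simp flip: add_divide_distrib)
    moreover have "(l + k) \<cdot>\<^sub>v ?z = l \<cdot>\<^sub>v x + k \<cdot>\<^sub>v y"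
      using False carrier by (simp add: smult_add_distrib_vec[of _ n] smult_smult_assoc)
    ultimately show ?thesis
      using homog_coneI[of "l + k" ?z K] v w carrier by (simp add: add_vCons)
  qed
qed

lemma homog_cone_sum:
  assumes K: "convex_vec n K" "K \<noteq> {}" and "finite Z"
    and "\<And>z. z \<in> Z \<Longrightarrow> w z \<ge> 0" "\<And>z. z \<in> Z \<Longrightarrow> w z > 0 \<Longrightarrow> X z \<in> K"
  shows "Matrix.vec (n + 1) (\<lambda>j. \<Sum>z\<in>Z. w z * vCons 1 (X z) $ j) \<in> homog_cone K"
  using assms(3-)
proof (induction Z rule: finite_induct)
  case empty
  obtain x where x: "x \<in> K" using K(2) by blast
  hence "Matrix.vec (n + 1) (\<lambda>j. 0) = vCons 0 (0 \<cdot>\<^sub>v x)"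
    using convex_vec_carrier[OF K(1) x] by (intro eq_vecI) (auto simp: vec_index_vCons)
  thus ?case using homog_coneI[OF order_refl x] by simp
next
  case (insert z Z)
  let ?sum = "\<lambda>Z. Matrix.vec (n + 1) (\<lambda>j. \<Sum>z\<in>Z. w z * vCons 1 (X z) $ j)"
  have IH: "?sum Z \<in> homog_cone K" using insert by simp
  show ?case
  proof (cases "w z = 0")
    case True
    thus ?thesis using IH insert.hyps by simp
  next
    case False
    hence w_pos: "w z > 0" using insert.prems(1)[of z] by simp
    hence X_in: "X z \<in> K" using insert.prems(2) by simp
    have "w z \<cdot>\<^sub>v vCons 1 (X z) \<in> homog_cone K"
      using homog_coneI[of "w z" "X z" K] w_pos X_in by (simp add: smult_vCons)
    hence "w z \<cdot>\<^sub>v vCons 1 (X z) + ?sum Z \<in> homog_cone K"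
      using IH by (intro homog_cone_add[OF K(1)])
    moreover have "w z \<cdot>\<^sub>v vCons 1 (X z) + ?sum Z = ?sum (insert z Z)"
      using insert.hyps convex_vec_carrier[OF K(1) X_in] by (intro eq_vecI) auto
    ultimately show ?thesis by simp
  qed
qed

lemma psd_mat_nonneg_combination:
  assumes A: "psd_mat d A" and B: "psd_mat d B" and "a \<ge> 0" "b \<ge> 0"
  shows "psd_mat d (a \<cdot>\<^sub>m A + b \<cdot>\<^sub>m B)"
proof -
  have carrier: "A \<in> carrier_mat d d" "B \<in> carrier_mat d d" using A B by (auto simp: psd_mat_def)
  have "(a \<cdot>\<^sub>m A + b \<cdot>\<^sub>m B)\<^sup>T = a \<cdot>\<^sub>m A\<^sup>T + b \<cdot>\<^sub>m B\<^sup>T" using carrier by (intro eq_matI) auto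
  moreover have "v \<bullet> ((a \<cdot>\<^sub>m A + b \<cdot>\<^sub>m B) *\<^sub>v v) = a * (v \<bullet> (A *\<^sub>v v)) + b * (v \<bullet> (B *\<^sub>v v))"
    if v: "v \<in> carrier_vec d" for v
  proof -
    have "(a \<cdot>\<^sub>m A + b \<cdot>\<^sub>m B) *\<^sub>v v = a \<cdot>\<^sub>v (A *\<^sub>v v) + b \<cdot>\<^sub>v (B *\<^sub>v v)"
      using carrier v by (intro eq_vecI) (auto simp: add_scalar_prod_distrib[of _ d])
    thus ?thesis using carrier v by (simp add: scalar_prod_add_distrib[of _ d])
  qed
  ultimately show ?thesis using assms carrier by (simp add: psd_mat_def)
qed

definition protection_matrix :: "nat \<Rightarrow> real vec set \<Rightarrow> real vec \<Rightarrow> real mat \<Rightarrow> bool" where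
  "protection_matrix n K x Y \<longleftrightarrow> psd_mat (n + 1) Y \<and>
     (\<forall>i\<le>n. Y $$ (i, i) = vCons 1 x $ i \<and> Y $$ (i, 0) = vCons 1 x $ i) \<and>
     (\<forall>i<n. col Y (Suc i) \<in> homog_cone K \<and> col Y 0 - col Y (Suc i) \<in> homog_cone K)"

lemma protection_matrix_carrier: "protection_matrix n K x Y \<Longrightarrow> Y \<in> carrier_mat (n + 1) (n + 1)"
  by (simp add: protection_matrix_def psd_mat_def)

lemma N_plus_iff_protection_matrix:
  "x \<in> N_plus n K \<longleftrightarrow> x \<in> carrier_vec n \<and> (\<exists>Y. protection_matrix n K x Y)"
proof -
  have "(\<forall>i\<in>{0..n}. Q i) \<longleftrightarrow> (\<forall>i\<le>n. Q i)" for Q by auto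
  moreover have "(\<forall>i\<in>{1..n}. Q i) \<longleftrightarrow> (\<forall>i<n. Q (Suc i))" for Q
    unfolding image_Suc_lessThan[symmetric] by blast
  ultimately show ?thesis
    by (auto simp: N_plus_def N_plus_cone_def protection_matrix_def)
qed

lemma protection_matrix_convex_combination:
  assumes K: "convex_vec n K" and x: "x \<in> carrier_vec n" and y: "y \<in> carrier_vec n"
    and X: "protection_matrix n K x X" and Y: "protection_matrix n K y Y"
    and ab: "a \<ge> 0" "b \<ge> 0" "a + b = 1"
  shows "protection_matrix n K (a \<cdot>\<^sub>v x + b \<cdot>\<^sub>v y) (a \<cdot>\<^sub>m X + b \<cdot>\<^sub>m Y)"
  unfolding protection_matrix_def
proof (intro conjI allI impI)
  let ?T = "a \<cdot>\<^sub>m X + b \<cdot>\<^sub>m Y" and ?z = "a \<cdot>\<^sub>v x + b \<cdot>\<^sub>v y"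
  note carrier = x y protection_matrix_carrier[OF X] protection_matrix_carrier[OF Y]
  show "psd_mat (n + 1) ?T"
    using X Y ab by (intro psd_mat_nonneg_combination) (auto simp: protection_matrix_def)
  fix i
  {
    assume i: "i \<le> n"
    hence "vCons 1 ?z $ i = a * vCons 1 x $ i + b * vCons 1 y $ i"
      using carrier ab(3) by (cases i) auto
    thus "?T $$ (i, i) = vCons 1 ?z $ i" "?T $$ (i, 0) = vCons 1 ?z $ i"
      using i carrier X Y by (auto simp: protection_matrix_def)
  next
    assume i: "i < n"
    have cone: "a \<cdot>\<^sub>v v + b \<cdot>\<^sub>v w \<in> homog_cone K" if "v \<in> homog_cone K" "w \<in> homog_cone K" for v w
      using that ab by (intro homog_cone_add[OF K] homog_cone_smult)
    have "col ?T (Suc i) = a \<cdot>\<^sub>v col X (Suc i) + b \<cdot>\<^sub>v col Y (Suc i)"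
      and "col ?T 0 - col ?T (Suc i) =
        a \<cdot>\<^sub>v (col X 0 - col X (Suc i)) + b \<cdot>\<^sub>v (col Y 0 - col Y (Suc i))"
      using i carrier by (auto intro!: eq_vecI simp: algebra_simps)
    thus "col ?T (Suc i) \<in> homog_cone K" "col ?T 0 - col ?T (Suc i) \<in> homog_cone K"
      using i X Y by (auto simp: protection_matrix_def intro!: cone)
  }
qed

lemma convex_vec_N_plus:
  assumes "convex_vec n K"
  shows "convex_vec n (N_plus n K)"
proof (rule convex_vecI)
  show "N_plus n K \<subseteq> carrier_vec n" by (auto simp: N_plus_def)
qed (use protection_matrix_convex_combination[OF assms] in
    \<open>fastforce simp: N_plus_iff_protection_matrix\<close>)

lemma convex_vec_N_plus_funpow: "convex_vec n K \<Longrightarrow> convex_vec n ((N_plus n ^^ r) K)"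
  by (induction r) (auto intro: convex_vec_N_plus)

definition bordered_mat :: "nat \<Rightarrow> real vec \<Rightarrow> (nat \<Rightarrow> nat \<Rightarrow> real) \<Rightarrow> real mat" where
  "bordered_mat n x M = mat (n + 1) (n + 1)
     (\<lambda>(i, j). case j of 0 \<Rightarrow> vCons 1 x $ i | Suc j' \<Rightarrow> vCons (x $ j') (Matrix.vec n (M j')) $ i)"

lemma psd_matI:
  assumes Y: "Y \<in> carrier_mat d d" and sym: "\<And>i j. i < d \<Longrightarrow> j < d \<Longrightarrow> Y $$ (i, j) = Y $$ (j, i)"
    and nonneg: "\<And>v. 0 \<le> (\<Sum>i<d. \<Sum>j<d. v i * v j * Y $$ (i, j))"
  shows "psd_mat d Y"
  unfolding psd_mat_def
proof (intro conjI ballI)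
  show "Y\<^sup>T = Y" using Y sym by (intro eq_matI) auto
  fix v :: "real vec" assume v: "v \<in> carrier_vec d"
  have "v \<bullet> (Y *\<^sub>v v) = (\<Sum>i<d. \<Sum>j<d. v $ i * v $ j * Y $$ (i, j))"
    using v Y by (auto simp: scalar_prod_def sum_distrib_left atLeast0LessThan intro!: sum.cong)
  thus "0 \<le> v \<bullet> (Y *\<^sub>v v)" using nonneg[of "\<lambda>i. v $ i"] by simp
qed (fact Y)

text \<open>\<open>M - x x\<^sup>T\<close> is the Schur complement of the corner entry 1.\<close>

lemma psd_mat_bordered_mat:
  fixes M :: "nat \<Rightarrow> nat \<Rightarrow> real"
  assumes x: "x \<in> carrier_vec n" and sym: "\<And>i j. i < n \<Longrightarrow> j < n \<Longrightarrow> M i j = M j i"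
    and psd: "\<And>u. 0 \<le> (\<Sum>i<n. \<Sum>j<n. u i * u j * (M i j - x $ i * x $ j))"
  shows "psd_mat (n + 1) (bordered_mat n x M)"
proof (rule psd_matI)
  let ?T = "bordered_mat n x M"
  show "?T \<in> carrier_mat (n + 1) (n + 1)" by (simp add: bordered_mat_def)
  show "?T $$ (i, j) = ?T $$ (j, i)" if "i < n + 1" "j < n + 1" for i j
    using that x sym by (cases i; cases j) (auto simp: bordered_mat_def)
  fix v :: "nat \<Rightarrow> real"
  let ?u = "\<lambda>i. v (Suc i)"
  let ?s = "\<Sum>i<n. ?u i * x $ i"
  have "(\<Sum>i<n+1. \<Sum>j<n+1. v i * v j * ?T $$ (i, j)) =
      v 0 * v 0 + (\<Sum>j<n. v 0 * ?u j * x $ j) +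
      ((\<Sum>i<n. ?u i * v 0 * x $ i) + (\<Sum>i<n. \<Sum>j<n. ?u i * ?u j * M j i))"
    by (simp add: sum.lessThan_Suc_shift bordered_mat_def sum.distrib del: sum.lessThan_Suc)
  also have "(\<Sum>i<n. \<Sum>j<n. ?u i * ?u j * M j i) =
      (\<Sum>i<n. \<Sum>j<n. ?u i * ?u j * (M i j - x $ i * x $ j)) + ?s * ?s"
    using sym by (simp add: sum_product algebra_simps flip: sum.distrib)
  also have "(\<Sum>j<n. v 0 * ?u j * x $ j) = v 0 * ?s" by (simp add: sum_distrib_left mult_ac)
  also have "(\<Sum>i<n. ?u i * v 0 * x $ i) = v 0 * ?s" by (simp add: sum_distrib_left mult_ac)
  also have "v 0 * v 0 + v 0 * ?s +
      (v 0 * ?s + ((\<Sum>i<n. \<Sum>j<n. ?u i * ?u j * (M i j - x $ i * x $ j)) + ?s * ?s)) =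
      (v 0 + ?s)\<^sup>2 + (\<Sum>i<n. \<Sum>j<n. ?u i * ?u j * (M i j - x $ i * x $ j))"
    by (simp add: power2_eq_square algebra_simps)
  also have "\<dots> \<ge> 0" using psd[of ?u] by simp
  finally show "0 \<le> (\<Sum>i<n+1. \<Sum>j<n+1. v i * v j * ?T $$ (i, j))" .
qed

lemma protection_matrix_bordered_mat:
  fixes M :: "nat \<Rightarrow> nat \<Rightarrow> real"
  assumes x: "x \<in> carrier_vec n"
    and psd: "psd_mat (n + 1) (bordered_mat n x M)" and diagonal: "\<And>i. i < n \<Longrightarrow> M i i = x $ i"
    and column: "\<And>i. i < n \<Longrightarrow> vCons (x $ i) (Matrix.vec n (M i)) \<in> homog_cone K"
    and complement: "\<And>i. i < n \<Longrightarrow> vCons (1 - x $ i) (x - Matrix.vec n (M i)) \<in> homog_cone K"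
  shows "protection_matrix n K x (bordered_mat n x M)"
  unfolding protection_matrix_def
proof (intro conjI allI impI)
  let ?T = "bordered_mat n x M"
  have col_0: "col ?T 0 = vCons 1 x"
    using x by (auto intro!: eq_vecI simp: bordered_mat_def)
  fix i
  {
    assume "i \<le> n"
    thus "?T $$ (i, i) = vCons 1 x $ i" "?T $$ (i, 0) = vCons 1 x $ i"
      using diagonal by (cases i; simp add: bordered_mat_def)+
  next
    assume i: "i < n"
    have col_Suc: "col ?T (Suc i) = vCons (x $ i) (Matrix.vec n (M i))"
      using i by (auto intro!: eq_vecI simp: bordered_mat_def)
    thus "col ?T (Suc i) \<in> homog_cone K" using column[OF i] by simp
    have "vCons 1 x - vCons (x $ i) (Matrix.vec n (M i)) =
        vCons (1 - x $ i) (x - Matrix.vec n (M i))"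
      using x by (intro eq_vecI) (auto simp: vec_index_vCons)
    thus "col ?T 0 - col ?T (Suc i) \<in> homog_cone K"
      using complement[OF i] by (simp add: col_0 col_Suc)
  }
qed (fact psd)

lemma covariance_eq_moment_minus_means:
  fixes p :: "'z \<Rightarrow> 'a::comm_ring_1"
  assumes "(\<Sum>z\<in>Z. p z) = 1" "(\<Sum>z\<in>Z. p z * f z) = a" "(\<Sum>z\<in>Z. p z * g z) = b"
  shows "(\<Sum>z\<in>Z. p z * ((f z - a) * (g z - b))) = (\<Sum>z\<in>Z. p z * (f z * g z)) - a * b"
proof -
  have "(\<Sum>z\<in>Z. p z * ((f z - a) * (g z - b))) =
      (\<Sum>z\<in>Z. p z * (f z * g z) - b * (p z * f z) - a * (p z * g z) + a * b * p z)"
    by (intro sum.cong refl) (simp add: algebra_simps)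
  also have "\<dots> = (\<Sum>z\<in>Z. p z * (f z * g z)) - b * a - a * b + a * b * 1"
    by (simp only: sum.distrib sum_subtractf assms flip: sum_distrib_left)
  finally show ?thesis by simp
qed

text \<open>
  The conditional means of the random point \<open>X i\<close>, given that its coordinate \<open>i\<close> is 1 or 0, are the
  normalised columns of the protection matrix.
\<close>

lemma N_plusI_random_points:
  fixes p :: "nat \<Rightarrow> 'z \<Rightarrow> real" and X :: "nat \<Rightarrow> 'z \<Rightarrow> real vec"
  assumes K: "convex_vec n K" and x: "x \<in> carrier_vec n"
    and finite: "\<And>i. i < n \<Longrightarrow> finite (Z i)"
    and nonneg: "\<And>i z. i < n \<Longrightarrow> z \<in> Z i \<Longrightarrow> 0 \<le> p i z"
    and total: "\<And>i. i < n \<Longrightarrow> (\<Sum>z\<in>Z i. p i z) = 1"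
    and mem: "\<And>i z. i < n \<Longrightarrow> z \<in> Z i \<Longrightarrow> 0 < p i z \<Longrightarrow> X i z \<in> K"
    and mean: "\<And>i j. i < n \<Longrightarrow> j < n \<Longrightarrow> (\<Sum>z\<in>Z i. p i z * X i z $ j) = x $ j"
    and zero_one: "\<And>i z. i < n \<Longrightarrow> z \<in> Z i \<Longrightarrow> X i z $ i \<in> {0, 1}"
  defines "cov i j \<equiv> \<Sum>z\<in>Z i. p i z * ((X i z $ i - x $ i) * (X i z $ j - x $ j))"
  assumes sym: "\<And>i j. i < n \<Longrightarrow> j < n \<Longrightarrow> cov i j = cov j i"
    and psd: "\<And>u. 0 \<le> (\<Sum>i<n. \<Sum>j<n. u i * u j * cov i j)"
  shows "x \<in> N_plus n K"
proof -
  define M where "M i j = (\<Sum>z\<in>Z i. p i z * (X i z $ i * X i z $ j))" for i j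
  have cov: "M i j - x $ i * x $ j = cov i j" if "i < n" "j < n" for i j
    unfolding cov_def M_def using that
    by (intro covariance_eq_moment_minus_means[symmetric] mean total)
  have cone: "Matrix.vec (n + 1) (\<lambda>j. \<Sum>z\<in>Z i. w z * vCons 1 (X i z) $ j) \<in> homog_cone K"
    if i: "i < n" and w: "\<And>z. z \<in> Z i \<Longrightarrow> 0 \<le> w z \<and> (w z = 0 \<or> w z = p i z)" for i w
  proof (rule homog_cone_sum[OF K _ finite[OF i]])
    obtain z where "z \<in> Z i" "p i z \<noteq> 0" using total[OF i] by (metis sum.neutral zero_neq_one)
    thus "K \<noteq> {}" using mem[OF i] nonneg[OF i] by (force simp: less_le)
  qed (use w mem[OF i] in force)+
  have "protection_matrix n K x (bordered_mat n x M)"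
  proof (rule protection_matrix_bordered_mat[OF x])
    show "psd_mat (n + 1) (bordered_mat n x M)"
    proof (rule psd_mat_bordered_mat[OF x])
      show "M i j = M j i" if "i < n" "j < n" for i j
        using cov[OF that] cov[OF that(2,1)] sym[OF that] by (simp add: mult.commute)
      show "0 \<le> (\<Sum>i<n. \<Sum>j<n. u i * u j * (M i j - x $ i * x $ j))" for u
        using psd[of u] by (simp add: cov)
    qed
    fix i assume i: "i < n"
    have square: "X i z $ i * X i z $ i = X i z $ i" if "z \<in> Z i" for z
      using zero_one[OF i that] by auto
    show "M i i = x $ i" using mean[OF i i] by (simp add: M_def square)
    have "vCons (x $ i) (Matrix.vec n (M i)) =
        Matrix.vec (n + 1) (\<lambda>j. \<Sum>z\<in>Z i. p i z * X i z $ i * vCons 1 (X i z) $ j)"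
      using i by (intro eq_vecI) (auto simp: vec_index_vCons M_def mean mult.assoc)
    also have "\<dots> \<in> homog_cone K" using zero_one[OF i] nonneg[OF i] by (intro cone i) force
    finally show "vCons (x $ i) (Matrix.vec n (M i)) \<in> homog_cone K" .
    have "vCons (1 - x $ i) (x - Matrix.vec n (M i)) =
        Matrix.vec (n + 1) (\<lambda>j. \<Sum>z\<in>Z i. p i z * (1 - X i z $ i) * vCons 1 (X i z) $ j)"
      using i x by (intro eq_vecI)
        (auto simp: vec_index_vCons M_def mean total algebra_simps sum_subtractf)
    also have "\<dots> \<in> homog_cone K" using zero_one[OF i] nonneg[OF i] by (intro cone i) force
    finally show "vCons (1 - x $ i) (x - Matrix.vec n (M i)) \<in> homog_cone K" .
  qed
  thus ?thesis using x by (auto simp: N_plus_iff_protection_matrix)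
qed

section \<open>One round\<close>

lemma block_gram_nonneg:
  fixes M :: "'i \<Rightarrow> 'i \<Rightarrow> real" and \<beta> :: "'i \<Rightarrow> 'b" and f :: "'b \<Rightarrow> 'i \<Rightarrow> 'z \<Rightarrow> real"
  assumes "finite I" and nonneg: "\<And>b z. 0 \<le> p b z"
    and M: "\<And>i j. i \<in> I \<Longrightarrow> j \<in> I \<Longrightarrow> M i j =
      (if \<beta> i = \<beta> j then \<Sum>z\<in>Z (\<beta> i). p (\<beta> i) z * (f (\<beta> i) i z * f (\<beta> i) j z) else 0)"
  shows "0 \<le> (\<Sum>i\<in>I. \<Sum>j\<in>I. u i * u j * M i j)"
proof -
  define B where "B b = {i \<in> I. \<beta> i = b}" for b
  have block: "0 \<le> (\<Sum>i\<in>B b. \<Sum>j\<in>B b. u i * u j * M i j)" for b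
  proof -
    have "(\<Sum>i\<in>B b. \<Sum>j\<in>B b. u i * u j * M i j) =
        (\<Sum>i\<in>B b. \<Sum>j\<in>B b. \<Sum>z\<in>Z b. p b z * ((u i * f b i z) * (u j * f b j z)))"
      by (intro sum.cong refl) (auto simp: B_def M sum_distrib_left mult_ac)
    also have "\<dots> = (\<Sum>i\<in>B b. \<Sum>z\<in>Z b. \<Sum>j\<in>B b. p b z * ((u i * f b i z) * (u j * f b j z)))"
      by (intro sum.cong refl sum.swap)
    also have "\<dots> = (\<Sum>z\<in>Z b. \<Sum>i\<in>B b. \<Sum>j\<in>B b. p b z * ((u i * f b i z) * (u j * f b j z)))"
      by (rule sum.swap)
    also have "\<dots> = (\<Sum>z\<in>Z b. p b z * (\<Sum>i\<in>B b. u i * f b i z)\<^sup>2)"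
      by (simp only: power2_eq_square sum_product) (simp only: sum_distrib_left)
    also have "\<dots> \<ge> 0" by (intro sum_nonneg mult_nonneg_nonneg nonneg) simp
    finally show ?thesis .
  qed
  have "(\<Sum>i\<in>I. \<Sum>j\<in>I. u i * u j * M i j) = (\<Sum>i\<in>I. \<Sum>j\<in>B (\<beta> i). u i * u j * M i j)"
    using \<open>finite I\<close> by (intro sum.cong refl sum.mono_neutral_right) (auto simp: B_def M)
  also have "\<dots> = (\<Sum>b\<in>\<beta> ` I. \<Sum>i\<in>B b. \<Sum>j\<in>B (\<beta> i). u i * u j * M i j)"
    unfolding B_def using \<open>finite I\<close> by (intro sum.group[symmetric]) auto
  also have "\<dots> = (\<Sum>b\<in>\<beta> ` I. \<Sum>i\<in>B b. \<Sum>j\<in>B b. u i * u j * M i j)"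
    by (intro sum.cong refl) (auto simp: B_def)
  also have "\<dots> \<ge> 0" by (intro sum_nonneg block)
  finally show ?thesis .
qed

definition half_point :: "nat \<Rightarrow> nat set \<Rightarrow> (nat \<Rightarrow> bool) \<Rightarrow> real vec" where
  "half_point n C \<rho> = Matrix.vec n (\<lambda>j. if j \<in> C then of_bool (\<rho> j) else 1 / 2)"

lemma half_point_carrier [simp]: "half_point n C \<rho> \<in> carrier_vec n"
  by (simp add: half_point_def)

lemma index_half_point:
  "j < n \<Longrightarrow> half_point n C \<rho> $ j = (if j \<in> C then of_bool (\<rho> j) else 1 / 2)"
  by (simp add: half_point_def)

text \<open>
  Every coordinate \<open>i\<close> has a block \<open>W (\<beta> i)\<close> of variables, empty if \<open>i\<close> is already fixed.
  Conditioning on \<open>i\<close> samples its block and leaves all variables outside the block unchanged, so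
  the covariance matrix is block diagonal.
\<close>

locale block_distribution =
  fixes n :: nat and C :: "nat set" and \<rho> :: "nat \<Rightarrow> bool"
    and \<beta> :: "nat \<Rightarrow> 'b" and W :: "'b \<Rightarrow> nat set" and p :: "'b \<Rightarrow> (nat \<Rightarrow> bool) \<Rightarrow> real"
  assumes cover: "i < n \<Longrightarrow> i \<in> C \<union> W (\<beta> i)"
    and same_block: "i < n \<Longrightarrow> j \<in> W (\<beta> i) \<Longrightarrow> j \<notin> C \<and> \<beta> j = \<beta> i"
    and finite_W: "i < n \<Longrightarrow> finite (W (\<beta> i))"
    and p_nonneg: "0 \<le> p b z"
    and sum_p: "i < n \<Longrightarrow> (\<Sum>z\<in>reassignments (W (\<beta> i)) \<rho>. p (\<beta> i) z) = 1"
    and sum_p_half: "i < n \<Longrightarrow> j \<in> W (\<beta> i) \<Longrightarrow>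
      (\<Sum>z\<in>reassignments (W (\<beta> i)) \<rho>. p (\<beta> i) z * of_bool (z j)) = 1 / 2"
begin

definition sampled_point :: "'b \<Rightarrow> (nat \<Rightarrow> bool) \<Rightarrow> real vec" where
  "sampled_point b z = half_point n (C \<union> W b) z"

definition covariance :: "nat \<Rightarrow> nat \<Rightarrow> real" where
  "covariance i j = (\<Sum>z\<in>reassignments (W (\<beta> i)) \<rho>. p (\<beta> i) z *
     ((sampled_point (\<beta> i) z $ i - half_point n C \<rho> $ i) *
      (sampled_point (\<beta> i) z $ j - half_point n C \<rho> $ j)))"

lemma index_sampled_point:
  assumes "i < n" "z \<in> reassignments (W (\<beta> i)) \<rho>" "j < n"
  shows "sampled_point (\<beta> i) z $ j =
    (if j \<in> W (\<beta> i) then of_bool (z j) else half_point n C \<rho> $ j)"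
  using assms same_block[OF assms(1)] reassignments_outside[OF assms(2)]
  by (auto simp: sampled_point_def index_half_point)

lemma sampled_point_zero_one:
  assumes "i < n" "z \<in> reassignments (W (\<beta> i)) \<rho>"
  shows "sampled_point (\<beta> i) z $ i \<in> {0, 1}"
  unfolding index_sampled_point[OF assms assms(1)]
  using cover[OF assms(1)] by (auto simp: index_half_point assms(1))

lemma mean_sampled_point:
  assumes "i < n" "j < n"
  shows "(\<Sum>z\<in>reassignments (W (\<beta> i)) \<rho>. p (\<beta> i) z * sampled_point (\<beta> i) z $ j) =
    half_point n C \<rho> $ j"
proof -
  have "(\<Sum>z\<in>reassignments (W (\<beta> i)) \<rho>. p (\<beta> i) z * sampled_point (\<beta> i) z $ j) =
      (\<Sum>z\<in>reassignments (W (\<beta> i)) \<rho>. p (\<beta> i) z *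
        (if j \<in> W (\<beta> i) then of_bool (z j) else half_point n C \<rho> $ j))"
    using assms by (intro sum.cong) (simp_all add: index_sampled_point)
  also have "\<dots> = half_point n C \<rho> $ j"
  proof (cases "j \<in> W (\<beta> i)")
    case True
    thus ?thesis
      using sum_p_half[OF assms(1) True] same_block[OF assms(1) True]
        index_half_point[OF assms(2)] by simp
  next
    case False
    thus ?thesis using sum_p[OF assms(1)] by (simp flip: sum_distrib_right)
  qed
  finally show ?thesis .
qed

lemma covariance_distinct_blocks:
  "i < n \<Longrightarrow> j < n \<Longrightarrow> \<beta> i \<noteq> \<beta> j \<Longrightarrow> covariance i j = 0"
  using same_block[of i j] by (auto simp: covariance_def index_sampled_point intro!: sum.neutral)

lemma half_point_in_N_plus:
  assumes K: "convex_vec n K"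
    and sampled: "\<And>i z. i < n \<Longrightarrow> z \<in> reassignments (W (\<beta> i)) \<rho> \<Longrightarrow> 0 < p (\<beta> i) z \<Longrightarrow>
      half_point n (C \<union> W (\<beta> i)) z \<in> K"
  shows "half_point n C \<rho> \<in> N_plus n K"
proof (rule N_plusI_random_points[OF K half_point_carrier[of n C \<rho>], where p = "\<lambda>i. p (\<beta> i)" and
      X = "\<lambda>i. sampled_point (\<beta> i)" and Z = "\<lambda>i. reassignments (W (\<beta> i)) \<rho>",
      folded covariance_def])
  show "sampled_point (\<beta> i) z \<in> K"
    if "i < n" "z \<in> reassignments (W (\<beta> i)) \<rho>" "0 < p (\<beta> i) z" for i z
    unfolding sampled_point_def using that by (rule sampled)
  show "covariance i j = covariance j i" if "i < n" "j < n" for i j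
    using that covariance_distinct_blocks[of i j] covariance_distinct_blocks[of j i]
    by (cases "\<beta> i = \<beta> j") (auto simp: covariance_def mult.commute)
  show "0 \<le> (\<Sum>i<n. \<Sum>j<n. u i * u j * covariance i j)" for u
    using covariance_distinct_blocks
    by (intro block_gram_nonneg[where p = p and \<beta> = \<beta> and Z = "\<lambda>b. reassignments (W b) \<rho>" and
          f = "\<lambda>b i z. sampled_point b z $ i - half_point n C \<rho> $ i"])
      (auto simp: p_nonneg covariance_def)
qed (simp_all add: finite_W p_nonneg sum_p mean_sampled_point sampled_point_zero_one
    del: insert_iff)

end

section \<open>Planted instances\<close>

locale planted_csp =
  fixes P :: "('k::finite \<Rightarrow> bool) \<Rightarrow> bool" and \<mu> :: "('k \<Rightarrow> bool) pmf" and t :: nat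
    and xs :: "'k constraint list" and n :: nat and d :: real
  assumes uniform: "wise_uniform (t - 1) \<mu>" and support: "set_pmf \<mu> \<subseteq> {z. P z}"
    and scope_less: "e < length xs \<Longrightarrow> snd (xs ! e) q < n" and d_pos: "0 < d"
begin

sublocale scope_family "scope ((!) xs)"
  by (rule scope_family_scope)

definition settled :: "nat set \<Rightarrow> (nat \<Rightarrow> bool) \<Rightarrow> nat \<Rightarrow> bool" where
  "settled C \<rho> e \<longleftrightarrow> scope ((!) xs) e \<subseteq> C \<and> P (constraint_input (xs ! e) \<rho>)"

lemma settled_mono:
  assumes "settled C \<rho> e" "C \<subseteq> C'" "\<And>v. v \<in> C \<Longrightarrow> z v = \<rho> v"
  shows "settled C' z e"
proof -
  have "constraint_input (xs ! e) z = constraint_input (xs ! e) \<rho>"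
    using assms(1,3) by (intro constraint_input_cong) (auto simp: settled_def)
  thus ?thesis using assms(1,2) by (auto simp: settled_def)
qed

lemma settled_if_local_weight_pos:
  assumes "0 < local_weight \<mu> ((!) xs) E z" "finite E" "e \<in> E" "vars E \<subseteq> C"
  shows "settled C z e"
  using constraint_input_in_set_pmf[OF assms(1-3)] support assms(3,4) by (auto simp: settled_def)

lemma le_arity_if_falsifiable:
  assumes "\<not> P f"
  shows "t \<le> CARD('k)"
proof (rule ccontr)
  assume "\<not> ?thesis"
  hence "2 ^ CARD('k) * (\<Sum>a\<in>reassignments {} f. pmf \<mu> a) = 1"
    by (subst sum_pmf_reassignments[OF uniform]) auto
  hence "f \<in> set_pmf \<mu>" by (auto simp: set_pmf_iff)
  thus False using support assms by blast
qed

lemma literal_half_point_nonneg: "j < n \<Longrightarrow> 0 \<le> literal (half_point n C \<rho> $ j) b"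
  by (simp add: index_half_point literal_def)

lemma sum_literal_ge_if_settled:
  assumes e: "e < length xs" and "settled C \<rho> e" "\<not> P f"
  shows "1 \<le> (\<Sum>i\<in>UNIV. literal (half_point n C \<rho> $ snd (xs ! e) i) (fst (xs ! e) i \<noteq> f i))"
proof -
  let ?l = "\<lambda>i. literal (half_point n C \<rho> $ snd (xs ! e) i) (fst (xs ! e) i \<noteq> f i)"
  have "constraint_input (xs ! e) \<rho> \<noteq> f" using assms(2,3) by (auto simp: settled_def)
  then obtain q where q: "(\<rho> (snd (xs ! e) q) \<noteq> fst (xs ! e) q) \<noteq> f q"
    by (auto simp: constraint_input_def fun_eq_iff)
  have "snd (xs ! e) q \<in> C" using assms(2) by (auto simp: settled_def scope_def)
  hence "?l q = 1" using q scope_less[OF e] by (auto simp: index_half_point literal_def)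
  moreover have "?l q \<le> (\<Sum>i\<in>UNIV. ?l i)"
    using literal_half_point_nonneg[OF scope_less[OF e]] by (intro member_le_sum) auto
  ultimately show ?thesis by simp
qed

lemma sum_literal_ge_if_two_free:
  assumes e: "e < length xs" and "2 \<le> card (scope ((!) xs) e - C)"
  shows "1 \<le> (\<Sum>i\<in>UNIV. literal (half_point n C \<rho> $ snd (xs ! e) i) (fst (xs ! e) i \<noteq> f i))"
proof -
  let ?S = "snd (xs ! e)" and ?Q = "{q. snd (xs ! e) q \<notin> C}"
  let ?l = "\<lambda>i. literal (half_point n C \<rho> $ ?S i) (fst (xs ! e) i \<noteq> f i)"
  have "scope ((!) xs) e - C = ?S ` ?Q" by (auto simp: scope_def)
  hence "2 \<le> card ?Q" using assms(2) card_image_le[of ?Q ?S] by simp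
  hence "1 \<le> (\<Sum>q\<in>?Q. 1 / 2 :: real)" by simp
  also have "\<dots> = (\<Sum>q\<in>?Q. ?l q)"
    using scope_less[OF e] by (intro sum.cong) (auto simp: index_half_point literal_def)
  also have "\<dots> \<le> (\<Sum>i\<in>UNIV. ?l i)"
    using literal_half_point_nonneg[OF scope_less[OF e]] by (intro sum_mono2) auto
  finally show ?thesis .
qed

lemma half_point_in_csp_polytope:
  assumes "\<And>e. e < length xs \<Longrightarrow> settled C \<rho> e \<or> 2 \<le> csp_surplus ((!) xs) t C {e}"
  shows "half_point n C \<rho> \<in> csp_polytope n P (mset xs)"
proof -
  have "1 \<le> (\<Sum>i\<in>UNIV. literal (half_point n C \<rho> $ S i) (c i \<noteq> f i))"
    if "(c, S) \<in> set xs" "\<not> P f" for c S f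
  proof -
    obtain e where e: "e < length xs" "xs ! e = (c, S)"
      using \<open>(c, S) \<in> set xs\<close> by (auto simp: in_set_conv_nth)
    consider "settled C \<rho> e" | "2 \<le> card (scope ((!) xs) e - C)"
      using assms[OF e(1)] le_arity_if_falsifiable[OF \<open>\<not> P f\<close>] card_scope_le[of "(!) xs" e]
      by (force simp: surplus_def)
    thus ?thesis
      using sum_literal_ge_if_settled[OF e(1) _ \<open>\<not> P f\<close>] sum_literal_ge_if_two_free[OF e(1)] e(2)
      by cases auto
  qed
  thus ?thesis by (auto simp: csp_polytope_def)
qed

abbreviation rounds :: "nat \<Rightarrow> real vec set" where
  "rounds r \<equiv> (N_plus n ^^ r) (csp_polytope n P (mset xs))"

lemma convex_vec_rounds: "convex_vec n (rounds r)"
proof (intro convex_vec_N_plus_funpow convex_vec_csp_polytope)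
  fix c S i assume "(c, S) \<in># mset xs"
  then obtain e where "e < length xs" "xs ! e = (c, S)" by (auto simp: in_set_conv_nth)
  thus "S i < n" using scope_less[of e i] by simp
qed

end

text \<open>\<open>L\<close> is the set of live constraints and \<open>a\<close> the slack that has been used up so far.\<close>

locale planted_state = planted_csp P \<mu> t xs n d
  for P :: "('k::finite \<Rightarrow> bool) \<Rightarrow> bool" and \<mu> t xs n d +
  fixes C L :: "nat set" and \<rho> :: "nat \<Rightarrow> bool" and s :: nat and a :: real
  assumes live: "L \<subseteq> {..<length xs}"
    and settled: "e < length xs \<Longrightarrow> e \<notin> L \<Longrightarrow> settled C \<rho> e"
    and expanding_state: "csp_expanding ((!) xs) t C L s (\<lambda>j. max 2 (d * j - a))"
    and a_nonneg: "0 \<le> a" and s_ge: "2 * (2 + a) \<le> d * s"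
begin

sublocale expanding_family "scope ((!) xs)" "2 * int CARD('k) - int t" C L s 2 d a
  using live expanding_state s_ge d_pos by unfold_locales (auto intro: finite_subset)

definition block :: "nat \<Rightarrow> nat set" where
  "block i = (if i \<in> C then {} else cluster i)"

definition block_vars :: "nat \<Rightarrow> nat set" where
  "block_vars i = insert i (vars (block i)) - C"

lemma finite_block: "finite (block i)"
  by (simp add: block_def finite_cluster)

lemma finite_block_vars: "finite (block_vars i)"
  using finite_vars[OF finite_block] by (simp add: block_vars_def)

lemma block_vars_disjoint: "block_vars i \<inter> C = {}"
  by (auto simp: block_vars_def)

lemma vars_block_subset: "vars (block i) \<subseteq> block_vars i \<union> C"
  by (auto simp: block_vars_def)

lemma fixed_block [simp]: "i \<in> C \<Longrightarrow> block i = {}" "i \<in> C \<Longrightarrow> block_vars i = {}"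
  by (auto simp: block_def block_vars_def)

lemma block_eq:
  assumes j: "j \<in> block_vars i"
  shows "block j = block i" "block_vars j = block_vars i"
proof -
  have C: "i \<notin> C" "j \<notin> C" using j block_vars_disjoint by fastforce+
  have "block j = block i \<and> block_vars j = block_vars i"
  proof (cases "j = i")
    case False
    hence j: "j \<in> vars (cluster i)" using j C by (auto simp: block_vars_def block_def)
    hence "cluster j = cluster i" using C by (intro cluster_eq)
    moreover have "i \<in> vars (cluster i)" using C(1) j by (cases rule: cluster_cases) auto
    ultimately show ?thesis using C j by (auto simp: block_vars_def block_def)
  qed simp
  thus "block j = block i" "block_vars j = block_vars i" by auto
qed

lemma card_block_le: "card (block i) \<le> s" "d * card (block i) \<le> 2 + a"
  using card_cluster_le[of i] a_nonneg by (auto simp: block_def)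

lemma surplus_block_ge:
  assumes "A \<subseteq> block i" "A \<noteq> {}"
  shows "2 \<le> csp_surplus ((!) xs) t C A"
proof (rule surplus_ge(1))
  show "card A \<le> s"
    using card_mono[OF finite_block assms(1)] card_block_le(1)[of i] by linarith
  show "A \<subseteq> L" using assms(1) cluster_subset by (auto simp: block_def split: if_splits)
qed fact

lemma sum_local_weight_block:
  "(\<Sum>z\<in>reassignments (block_vars i) \<rho>. local_weight \<mu> ((!) xs) (block i) z) =
    2 ^ card (block_vars i)"
proof (rule sum_local_weight[OF uniform finite_block finite_block_vars vars_block_subset
      block_vars_disjoint])
  show "0 < csp_surplus ((!) xs) t C A" if "A \<subseteq> block i" "A \<noteq> {}" for A
    using surplus_block_ge[OF that] by simp
qed

lemma sum_local_weight_block_mult_of_bool: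
  "j \<in> block_vars i \<Longrightarrow>
    (\<Sum>z\<in>reassignments (block_vars i) \<rho>. local_weight \<mu> ((!) xs) (block i) z * of_bool (z j)) =
      2 ^ card (block_vars i) / 2"
  by (rule sum_local_weight_mult_of_bool[OF uniform finite_block finite_block_vars
        vars_block_subset block_vars_disjoint surplus_block_ge])

lemma slack_after_conditioning:
  "d * s - 2 * (d * card (block i)) \<le> d * real (s - card (block i))"
proof -
  have "d * real (s - card (block i)) = d * s - d * card (block i)"
    using card_block_le(1)[of i] by (simp add: of_nat_diff right_diff_distrib)
  moreover have "0 \<le> d * card (block i)" using d_pos by simp
  ultimately show ?thesis by simp
qed

lemma planted_state_after_conditioning:
  assumes i: "i \<notin> C" and z: "z \<in> reassignments (block_vars i) \<rho>"
    and pos: "0 < local_weight \<mu> ((!) xs) (block i) z" and s: "2 * (4 + a) \<le> d * s"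
  shows "planted_state P \<mu> t xs n d (C \<union> block_vars i) (L - block i) z
    (s - card (block i)) (a + 2 - d * card (block i))"
proof
  show "L - block i \<subseteq> {..<length xs}" using live by auto
  show "csp_expanding ((!) xs) t (C \<union> block_vars i) (L - block i) (s - card (block i))
      (\<lambda>j. max 2 (d * j - (a + 2 - d * card (block i))))"
    using expanding_after_conditioning[OF _ _ i] i a_nonneg
    by (simp add: block_vars_def block_def)
  show "0 \<le> a + 2 - d * card (block i)" using card_block_le(2)[of i] by simp
  show "2 * (2 + (a + 2 - d * card (block i))) \<le> d * real (s - card (block i))"
    using slack_after_conditioning[of i] s by simp
  fix e assume e: "e < length xs" "e \<notin> L - block i"
  show "settled (C \<union> block_vars i) z e"
  proof (cases "e \<in> L")
    case True
    thus ?thesis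
      using e vars_block_subset by (intro settled_if_local_weight_pos[OF pos finite_block]) auto
  next
    case False
    show ?thesis
    proof (rule settled_mono[OF settled[OF e(1) False]])
      show "z v = \<rho> v" if "v \<in> C" for v
        using that block_vars_disjoint by (intro reassignments_outside[OF z]) auto
    qed simp
  qed
qed

sublocale block_distribution n C \<rho> "\<lambda>i. (block i, block_vars i)" snd
  "\<lambda>b z. local_weight \<mu> ((!) xs) (fst b) z / 2 ^ card (snd b)"
proof
  show "i \<in> C \<union> snd (block i, block_vars i)" for i
    by (simp add: block_vars_def)
  show "j \<notin> C \<and> (block j, block_vars j) = (block i, block_vars i)"
    if "j \<in> snd (block i, block_vars i)" for i j
    using that block_vars_disjoint block_eq by auto
  show "(\<Sum>z\<in>reassignments (snd (block i, block_vars i)) \<rho>.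
      local_weight \<mu> ((!) xs) (fst (block i, block_vars i)) z /
        2 ^ card (snd (block i, block_vars i)) * of_bool (z j)) = 1 / 2"
    if "j \<in> snd (block i, block_vars i)" for i j
    using sum_local_weight_block_mult_of_bool[of j i] that by (simp flip: sum_divide_distrib)
qed (simp_all add: finite_block_vars local_weight_nonneg sum_local_weight_block
    flip: sum_divide_distrib)

lemma half_point_in_N_plus_if_sampled:
  assumes "convex_vec n K"
    and "\<And>i z. z \<in> reassignments (block_vars i) \<rho> \<Longrightarrow>
      0 < local_weight \<mu> ((!) xs) (block i) z \<Longrightarrow> half_point n (C \<union> block_vars i) z \<in> K"
  shows "half_point n C \<rho> \<in> N_plus n K"
  using assms by (intro half_point_in_N_plus) (auto simp: zero_less_divide_iff)

end

context planted_csp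
begin

lemma half_point_in_rounds:
  assumes "planted_state P \<mu> t xs n d C L \<rho> s a" "2 * (2 + a + 2 * real r) \<le> d * s"
  shows "half_point n C \<rho> \<in> rounds r"
  using assms
proof (induction r arbitrary: C L \<rho> s a)
  case 0
  interpret planted_state P \<mu> t xs n d C L \<rho> s a by fact
  have "s \<noteq> 0" using s_ge a_nonneg by (intro notI) simp
  hence "settled C \<rho> e \<or> 2 \<le> csp_surplus ((!) xs) t C {e}" if "e < length xs" for e
    using settled[OF that] surplus_ge(1)[of "{e}"] by auto
  thus ?case by (simp add: half_point_in_csp_polytope)
next
  case (Suc r)
  interpret planted_state P \<mu> t xs n d C L \<rho> s a by fact
  have "half_point n C \<rho> \<in> N_plus n (rounds r)"
  proof (rule half_point_in_N_plus_if_sampled[OF convex_vec_rounds])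
    fix i z
    assume z: "z \<in> reassignments (block_vars i) \<rho>"
      and weight_pos: "0 < local_weight \<mu> ((!) xs) (block i) z"
    show "half_point n (C \<union> block_vars i) z \<in> rounds r"
    proof (cases "i \<in> C")
      case True
      hence "z = \<rho>" using z by simp
      thus ?thesis using True Suc.prems by (simp add: Suc.IH[of C L \<rho> s a])
    next
      case False
      have "2 * (4 + a) \<le> d * s" using Suc.prems(2) by simp
      with False z weight_pos
      have "planted_state P \<mu> t xs n d (C \<union> block_vars i) (L - block i) z
          (s - card (block i)) (a + 2 - d * card (block i))"
        by (intro planted_state_after_conditioning) auto
      moreover have "2 * (2 + (a + 2 - d * card (block i)) + 2 * real r) \<le>
          d * real (s - card (block i))"
        using slack_after_conditioning[of i] Suc.prems(2) by simp
      ultimately show ?thesis by (rule Suc.IH)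
    qed
  qed
  thus ?case by simp
qed

end

locale expanding_planted_csp = planted_csp P \<mu> t xs n d
  for P :: "('k::finite \<Rightarrow> bool) \<Rightarrow> bool" and \<mu> t xs n d +
  fixes s :: nat
  assumes expanding_instance: "csp_expanding ((!) xs) t {} {..<length xs} s (\<lambda>j. d * j)"
    and two_le: "2 \<le> d * s"
begin

lemma surplus_pos:
  assumes "A \<subseteq> {..<length xs}" "A \<noteq> {}" "card A \<le> s"
  shows "0 < csp_surplus ((!) xs) t {} A"
proof -
  have "0 < card A" using assms(1,2) finite_subset by (fastforce simp: card_gt_0_iff)
  hence "0 < d * card A" using d_pos by simp
  thus ?thesis using expandingD[OF expanding_instance assms] by linarith
qed

sublocale expanding_family "scope ((!) xs)" "2 * int CARD('k) - int t" "{}" "{..<length xs}"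
  s 1 d 0
proof
  have "max 1 (d * card A) \<le> csp_surplus ((!) xs) t {} A"
    if "A \<subseteq> {..<length xs}" "A \<noteq> {}" "card A \<le> s" for A
    using surplus_pos[OF that] expandingD[OF expanding_instance that] by simp
  thus "csp_expanding ((!) xs) t {} {..<length xs} s (\<lambda>j. max (real_of_int 1) (d * j - 0))"
    unfolding expanding_def by simp
qed (use two_le d_pos in auto)

lemma exists_assignment_tight:
  assumes A: "A \<in> tight"
  shows "\<exists>z. 0 < local_weight \<mu> ((!) xs) A z"
proof (rule ccontr)
  assume "\<not> ?thesis"
  hence zero: "local_weight \<mu> ((!) xs) A z = 0" for z
    using local_weight_nonneg[of \<mu> "(!) xs" A z] by (metis less_eq_real_def)
  have finite: "finite A" using A by (intro finite_subset_L tight_subset)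
  have "(\<Sum>z\<in>reassignments (vars A) undefined. local_weight \<mu> ((!) xs) A z) = 2 ^ card (vars A)"
  proof (rule sum_local_weight[OF uniform, where C = "{}"])
    fix B assume B: "B \<subseteq> A" "B \<noteq> {}"
    have "card B \<le> card A" using finite B(1) by (rule card_mono)
    thus "0 < csp_surplus ((!) xs) t {} B"
      using A B by (intro surplus_pos) (auto simp: tight_def)
  qed (use finite finite_vars in auto)
  thus False by (simp add: zero)
qed

text \<open>Distinct clusters share no variables, so their assignments can be combined.\<close>

lemma exists_assignment_closure:
  "\<exists>\<rho>. \<forall>e\<in>\<Union>tight. settled (vars (\<Union>tight)) \<rho> e"
proof -
  obtain z where z: "\<And>A. A \<in> tight \<Longrightarrow> 0 < local_weight \<mu> ((!) xs) A (z A)"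
    using exists_assignment_tight by metis
  define \<rho> where "\<rho> v = z (cluster v) v" for v
  have "settled (vars (\<Union>tight)) \<rho> e" if e: "e \<in> \<Union>tight" for e
  proof -
    obtain A where A: "A \<in> tight" "e \<in> A" using e by blast
    let ?S = "snd (xs ! e)"
    define E where "E = cluster (?S undefined)"
    have S_in: "?S q \<in> vars B" if "e \<in> B" for q B using that by (auto simp: scope_def)
    have E: "E \<in> tight" "e \<in> E"
      using cluster_tight[OF A(1) S_in[OF A(2)]] tight_subset_cluster[OF A(1) S_in[OF A(2)]] A(2)
      by (auto simp: E_def)
    have "cluster (?S q) = E" for q
      using cluster_eq[of "?S undefined" "?S q"] S_in[OF E(2)] by (simp add: E_def)
    hence "constraint_input (xs ! e) \<rho> = constraint_input (xs ! e) (z E)"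
      by (simp add: constraint_input_def \<rho>_def)
    moreover have "settled (vars (\<Union>tight)) (z E) e"
      using E(1)
      by (intro settled_if_local_weight_pos[OF z[OF E(1)] _ E(2)] finite_subset_L tight_subset) auto
    ultimately show ?thesis by (simp add: settled_def)
  qed
  thus ?thesis by blast
qed

lemma exists_planted_state:
  assumes "s' * (1 + CARD('k) / d) \<le> s" "4 \<le> d * s'"
  shows "\<exists>C L \<rho>. planted_state P \<mu> t xs n d C L \<rho> s' 0"
proof -
  obtain \<rho> where \<rho>: "\<And>e. e \<in> \<Union>tight \<Longrightarrow> settled (vars (\<Union>tight)) \<rho> e"
    using exists_assignment_closure by blast
  have "csp_expanding ((!) xs) t (vars (\<Union>tight)) ({..<length xs} - \<Union>tight) s'
      (\<lambda>j. max 2 (d * j - 0))"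
    using expanding_after_closure[of "CARD('k)" s'] assms(1) card_scope_le[of "(!) xs"] by simp
  hence "planted_state P \<mu> t xs n d (vars (\<Union>tight)) ({..<length xs} - \<Union>tight) \<rho> s' 0"
    using \<rho> assms(2) by unfold_locales auto
  thus ?thesis by blast
qed

end

lemma (in planted_csp) rounds_nonempty:
  assumes "csp_expanding ((!) xs) t {} {..<length xs} s (\<lambda>j. d * j)"
    and s: "(4 * (real r + 1) / d + 1) * (1 + CARD('k) / d) \<le> s"
  shows "rounds r \<noteq> {}"
proof -
  define s' where "s' = nat \<lceil>4 * (real r + 1) / d\<rceil>"
  have ratio: "1 \<le> 1 + CARD('k) / d" using d_pos by simp
  have "0 \<le> 4 * (real r + 1) / d" using d_pos by simp
  hence s': "4 * (real r + 1) / d \<le> s'" "s' \<le> 4 * (real r + 1) / d + 1"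
    unfolding s'_def by linarith+
  have s'_le: "s' * (1 + CARD('k) / d) \<le> s"
    by (rule order_trans[OF mult_right_mono[OF s'(2)] s]) (use ratio in simp)
  have d_s': "4 * (real r + 1) \<le> d * s'" using s'(1) d_pos by (simp add: field_simps)
  have "real s' \<le> s" using order_trans[OF _ s'_le, of s'] mult_left_mono[OF ratio, of s'] by simp
  hence "d * s' \<le> d * s" using d_pos by simp
  then interpret expanding_planted_csp P \<mu> t xs n d s
    using assms(1) d_s' by unfold_locales auto
  obtain C L \<rho> where "planted_state P \<mu> t xs n d C L \<rho> s' 0"
    using exists_planted_state[OF s'_le] d_s' by auto
  hence "half_point n C \<rho> \<in> rounds r"
    using d_s' by (intro half_point_in_rounds) auto
  thus ?thesis by blast
qed

section \<open>Expansion of random instances\<close>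

lemma emeasure_replicate_pmf_nth:
  "J \<subseteq> {..<m} \<Longrightarrow> emeasure (replicate_pmf m p) {xs. \<forall>i\<in>J. xs ! i \<in> B} = emeasure p B ^ card J"
proof (induction m arbitrary: J)
  case 0
  thus ?case by simp
next
  case (Suc m)
  define J' where "J' = {i. Suc i \<in> J}"
  define c where "c = emeasure p B ^ card J'"
  have "J' \<subseteq> {..<m}" and finite: "finite J"
    using Suc.prems finite_subset by (auto simp: J'_def)
  hence IH: "emeasure (replicate_pmf m p) {xs. \<forall>i\<in>J'. xs ! i \<in> B} = c"
    unfolding c_def by (intro Suc.IH)
  have "J - {0} = Suc ` J'" unfolding J'_def by (auto simp: image_iff) (metis not0_implies_Suc)
  hence card_J': "card J' = card (J - {0})" by (simp add: card_image)
  have tail: "{xs. \<forall>i\<in>J. (x # xs) ! i \<in> B} =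
      (if 0 \<in> J \<and> x \<notin> B then {} else {xs. \<forall>i\<in>J'. xs ! i \<in> B})" for x
    by (auto simp: J'_def nth_Cons split: nat.splits)
  have "replicate_pmf (Suc m) p = bind_pmf p (\<lambda>x. map_pmf ((#) x) (replicate_pmf m p))"
    by (simp add: map_pmf_def)
  hence "emeasure (replicate_pmf (Suc m) p) {xs. \<forall>i\<in>J. xs ! i \<in> B} =
      (\<integral>\<^sup>+x. emeasure (replicate_pmf m p) {xs. \<forall>i\<in>J. (x # xs) ! i \<in> B} \<partial>p)"
    by (simp add: vimage_def)
  also have "\<dots> = (\<integral>\<^sup>+x. (if 0 \<in> J \<and> x \<notin> B then 0 else c) \<partial>p)"
    unfolding tail by (intro nn_integral_cong) (auto simp: IH)
  also have "\<dots> = emeasure p B ^ card J"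
  proof (cases "0 \<in> J")
    case True
    have "(\<integral>\<^sup>+x. (if 0 \<in> J \<and> x \<notin> B then 0 else c) \<partial>p) = (\<integral>\<^sup>+x. c * indicator B x \<partial>p)"
      using True by (intro nn_integral_cong) (auto simp: indicator_def)
    also have "\<dots> = c * emeasure p B" by (rule nn_integral_cmult_indicator) simp
    also have "\<dots> = emeasure p B ^ Suc (card J')" by (simp add: c_def mult.commute)
    also have "Suc (card J') = card J" using True finite card_J' by (metis card_Suc_Diff1)
    finally show ?thesis .
  next
    case False
    thus ?thesis using card_J' by (simp add: c_def)
  qed
  finally show ?case .
qed

lemma prob_replicate_pmf_nth:
  "J \<subseteq> {..<m} \<Longrightarrow>
    measure_pmf.prob (replicate_pmf m p) {xs. \<forall>i\<in>J. xs ! i \<in> B} = measure_pmf.prob p B ^ card J"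
  using emeasure_replicate_pmf_nth[of J m p B]
  by (simp add: measure_pmf.emeasure_eq_measure ennreal_power)

lemma constraints_eq: "constraints n = UNIV \<times> (UNIV \<rightarrow>\<^sub>E {..<n})"
  by (auto simp: constraints_def PiE_def)

lemma finite_constraints: "finite (constraints n :: 'k::finite constraint set)"
  unfolding constraints_eq by (intro finite_cartesian_product finite_PiE) auto

lemma card_constraints:
  "card (constraints n :: 'k::finite constraint set) = 2 ^ CARD('k) * n ^ CARD('k)"
  by (simp add: constraints_eq card_cartesian_product card_funcsetE card_fun)

lemma constraints_nonempty: "n > 0 \<Longrightarrow> (constraints n :: 'k::finite constraint set) \<noteq> {}"
  using card_constraints[where 'k = 'k, of n] by auto

abbreviation random_constraints :: "nat \<Rightarrow> nat \<Rightarrow> 'k::finite constraint list pmf" where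
  "random_constraints n m \<equiv> replicate_pmf m (pmf_of_set (constraints n))"

lemma set_pmf_random_constraints:
  assumes "n > 0" "xs \<in> set_pmf (random_constraints n m :: 'k::finite constraint list pmf)"
  shows "length xs = m" "i < m \<Longrightarrow> snd (xs ! i) q < n"
proof -
  have "set_pmf (pmf_of_set (constraints n)) = (constraints n :: 'k constraint set)"
    using assms(1) by (intro set_pmf_of_set constraints_nonempty finite_constraints)
  hence "length xs = m" "set xs \<subseteq> constraints n" using assms(2) by (auto simp: set_replicate_pmf)
  thus "length xs = m" "i < m \<Longrightarrow> snd (xs ! i) q < n" by (auto simp: constraints_def dest!: nth_mem)
qed

lemma prob_constraint_range_subset:
  assumes "n > 0" "V \<subseteq> {..<n}"
  shows "measure_pmf.prob (pmf_of_set (constraints n :: 'k::finite constraint set))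
    {e. range (snd e) \<subseteq> V} = (card V / n) ^ CARD('k)"
proof -
  have "constraints n \<inter> {e. range (snd e) \<subseteq> V} = (UNIV :: ('k \<Rightarrow> bool) set) \<times> (UNIV \<rightarrow>\<^sub>E V)"
    using assms(2) by (auto simp: constraints_eq PiE_def)
  hence "card (constraints n \<inter> {e :: 'k constraint. range (snd e) \<subseteq> V}) =
      2 ^ CARD('k) * card V ^ CARD('k)"
    by (simp add: card_cartesian_product card_funcsetE card_fun)
  thus ?thesis
    using assms(1) by (simp add: measure_pmf_of_set constraints_nonempty finite_constraints
        card_constraints power_divide)
qed

lemma prob_few_vars_le:
  assumes n: "n > 0" and J: "J \<subseteq> {..<m}" and v: "v \<le> n"
  shows "measure_pmf.prob (random_constraints n m :: 'k::finite constraint list pmf)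
      {xs. card (\<Union>(scope ((!) xs) ` J)) \<le> v} \<le> (n choose v) * (v / n) ^ (CARD('k) * card J)"
proof -
  let ?M = "random_constraints n m :: 'k constraint list pmf"
  let ?inside = "\<lambda>V. {xs :: 'k constraint list. \<forall>i\<in>J. xs ! i \<in> {e. range (snd e) \<subseteq> V}}"
  let ?\<V> = "{V. V \<subseteq> {..<n} \<and> card V = v}"
  have finite: "finite ?\<V>" by (rule finite_subset[of _ "Pow {..<n}"]) auto
  have "measure_pmf.prob ?M {xs. card (\<Union>(scope ((!) xs) ` J)) \<le> v}
      \<le> measure_pmf.prob ?M (\<Union>V\<in>?\<V>. ?inside V)"
  proof (rule measure_pmf.finite_measure_mono_AE)
    show "AE xs in ?M. xs \<in> {xs. card (\<Union>(scope ((!) xs) ` J)) \<le> v} \<longrightarrow>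
        xs \<in> (\<Union>V\<in>?\<V>. ?inside V)"
      unfolding AE_measure_pmf_iff
    proof (intro ballI impI)
      fix xs assume xs: "xs \<in> set_pmf ?M"
        and few: "xs \<in> {xs. card (\<Union>(scope ((!) xs) ` J)) \<le> v}"
      have "\<Union>(scope ((!) xs) ` J) \<subseteq> {..<n}"
        using set_pmf_random_constraints(2)[OF n xs] J by (auto simp: scope_def)
      then obtain V where V: "\<Union>(scope ((!) xs) ` J) \<subseteq> V" "V \<subseteq> {..<n}" "card V = v"
        using exists_subset_between[of "\<Union>(scope ((!) xs) ` J)" v "{..<n}"] few v by auto
      hence "xs \<in> ?inside V" by (auto simp: scope_def)
      thus "xs \<in> (\<Union>V\<in>?\<V>. ?inside V)" using V by blast
    qed
  qed simp
  also have "\<dots> \<le> (\<Sum>V\<in>?\<V>. measure_pmf.prob ?M (?inside V))"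
    using finite by (intro measure_pmf.finite_measure_subadditive_finite) auto
  also have "\<dots> = (\<Sum>V\<in>?\<V>. (v / n) ^ (CARD('k) * card J))"
  proof (rule sum.cong)
    fix V assume V: "V \<in> ?\<V>"
    show "measure_pmf.prob ?M (?inside V) = (v / n) ^ (CARD('k) * card J)"
      unfolding prob_replicate_pmf_nth[OF J]
      using V prob_constraint_range_subset[OF n, of V, where 'k = 'k] by (simp add: power_mult)
  qed simp
  also have "\<dots> = (n choose v) * (v / n) ^ (CARD('k) * card J)"
    using n_subsets[of "{..<n}" v] by simp
  finally show ?thesis .
qed

lemma self_power_le_exp_mult_fact: "real j ^ j \<le> exp j * fact j"
proof -
  have "(\<Sum>i\<in>{j}. real j ^ i /\<^sub>R fact i) \<le> (\<Sum>i. real j ^ i /\<^sub>R fact i)"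
    using summable_exp_generic[of "real j"] by (intro sum_le_suminf) auto
  thus ?thesis by (simp add: exp_def field_simps)
qed

lemma binomial_le_exp_power: "real (m choose j) \<le> (exp 1 * m / j) ^ j"
proof (cases "j = 0")
  case False
  have "real (m choose j) * fact j \<le> real m ^ j"
    using binomial_fact_pow[of m j] by (metis of_nat_fact of_nat_le_iff of_nat_mult of_nat_power)
  hence "real (m choose j) * fact j * (exp j * real j ^ j) \<le> real m ^ j * (exp j * real j ^ j)"
    by (intro mult_right_mono) auto
  also have "\<dots> \<le> real m ^ j * (exp j * (exp j * fact j))"
    using self_power_le_exp_mult_fact by (intro mult_left_mono) auto
  finally have "real (m choose j) * real j ^ j \<le> real m ^ j * exp j" by simp
  thus ?thesis
    using False by (simp add: power_divide power_mult_distrib field_simps flip: exp_of_nat_mult)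
qed simp

lemma binomial_mult_power_le:
  assumes "v \<le> q" "n > 0"
  shows "(n choose v) * (v / n) ^ q \<le> exp v * (v / n) ^ (q - v)"
proof (cases "v = 0")
  case False
  have "(n choose v) * (v / n) ^ q = (n choose v) * (v / n) ^ v * (v / n) ^ (q - v)"
    using assms(1) by (simp add: mult.assoc flip: power_add)
  also have "\<dots> \<le> (exp 1 * n / v) ^ v * (v / n) ^ v * (v / n) ^ (q - v)"
    using binomial_le_exp_power by (intro mult_right_mono) auto
  also have "(exp 1 * n / v) ^ v * (v / n) ^ v = exp v"
    using False assms(2) by (simp add: exp_of_nat_mult[symmetric] flip: power_mult_distrib)
  finally show ?thesis .
qed simp

lemma binomial_mult_power_le_powr:
  assumes "v \<le> q" "q \<le> n" "0 < q" "w \<le> real q - real v"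
  shows "(n choose v) * (v / n) ^ q \<le> exp (real q) * (q / n) powr w"
proof -
  have "(n choose v) * (v / n) ^ q \<le> exp v * (v / n) ^ (q - v)"
    using assms(1-3) by (intro binomial_mult_power_le) auto
  also have "\<dots> \<le> exp q * (q / n) ^ (q - v)"
    using assms(1) by (intro mult_mono power_mono divide_right_mono) auto
  also have "\<dots> = exp q * (q / n) powr (real q - real v)"
    using assms(1-3) by (simp add: powr_realpow[symmetric] of_nat_diff)
  also have "\<dots> \<le> exp q * (q / n) powr w"
    using assms by (intro mult_left_mono powr_mono') auto
  finally show ?thesis .
qed

text \<open>
  A set of \<open>j\<close> constraints of surplus less than \<open>d j\<close> has at least \<open>(t - d) j / 2\<close> fewer variables
  than positions.
\<close>

lemma prob_surplus_less_le:
  fixes d :: real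
  assumes n: "n > 0" and J: "J \<subseteq> {..<m}" and d: "d \<le> t"
  defines "k \<equiv> CARD('k::finite)" and "j \<equiv> card J" and "\<theta> \<equiv> (t - d) / 2"
  shows "measure_pmf.prob (random_constraints n m :: 'k constraint list pmf)
      {xs. csp_surplus ((!) xs) t {} J < d * j}
    \<le> exp (real (k * j)) * (real (k * j) / n) powr (\<theta> * j)"
proof -
  let ?M = "random_constraints n m :: 'k constraint list pmf"
  let ?vars = "\<lambda>xs :: 'k constraint list. \<Union>(scope ((!) xs) ` J)"
  have few_vars_iff: "csp_surplus ((!) xs) t {} J < d * j \<longleftrightarrow> card (?vars xs) < (k - \<theta>) * j"
    for xs :: "'k constraint list"
    by (simp add: surplus_def \<theta>_def k_def j_def field_simps)
  consider "n < k * j" | "(k - \<theta>) * j \<le> 0" | "k * j \<le> n" "0 < (k - \<theta>) * j" by linarith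
  thus ?thesis
  proof cases
    case 1
    hence "1 \<le> real (k * j) / n" using n by (simp add: field_simps flip: of_nat_mult)
    hence "1 \<le> (real (k * j) / n) powr (\<theta> * j)"
      using d by (intro ge_one_powr_ge_zero) (auto simp: \<theta>_def)
    moreover have "1 \<le> exp (real (k * j))" by simp
    ultimately have "1 * 1 \<le> exp (real (k * j)) * (real (k * j) / n) powr (\<theta> * j)"
      by (intro mult_mono) auto
    thus ?thesis by (intro order_trans[OF measure_pmf.prob_le_1]) simp
  next
    case 2
    have "\<not> csp_surplus ((!) xs) t {} J < d * j" for xs :: "'k constraint list"
      unfolding few_vars_iff using 2 of_nat_0_le_iff[of "card (?vars xs)"] by linarith
    thus ?thesis by simp
  next
    case 3
    define v where "v = nat \<lfloor>(k - \<theta>) * j\<rfloor>"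
    have v: "v \<le> (k - \<theta>) * j" using 3(2) by (simp add: v_def)
    have "0 \<le> \<theta> * j" using d by (simp add: \<theta>_def)
    hence "real v \<le> real (k * j)" using v by (simp add: algebra_simps)
    hence v_le: "v \<le> k * j" by (simp only: of_nat_le_iff)
    have "measure_pmf.prob ?M {xs. csp_surplus ((!) xs) t {} J < d * j} \<le>
        measure_pmf.prob ?M {xs. card (?vars xs) \<le> v}"
      by (intro measure_pmf.finite_measure_mono) (auto simp: few_vars_iff v_def le_nat_floor)
    also have "\<dots> \<le> (n choose v) * (v / n) ^ (k * j)"
      unfolding k_def j_def using v_le 3(1) by (intro prob_few_vars_le n J) simp
    also have "\<dots> \<le> exp (real (k * j)) * (real (k * j) / n) powr (\<theta> * j)"
    proof (rule binomial_mult_power_le_powr)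
      show "0 < k * j" using 3(2) by (cases "j = 0") (auto simp: k_def)
      show "\<theta> * j \<le> real (k * j) - real v" using v by (simp add: algebra_simps)
    qed fact+
    finally show ?thesis .
  qed
qed

definition failure_ratio :: "nat \<Rightarrow> real \<Rightarrow> nat \<Rightarrow> nat \<Rightarrow> nat \<Rightarrow> real" where
  "failure_ratio k \<theta> n m j = exp (k + 1) * k powr \<theta> * m * j powr (\<theta> - 1) / n powr \<theta>"

lemma failure_ratio_nonneg: "0 \<le> failure_ratio k \<theta> n m j"
  by (simp add: failure_ratio_def)

lemma prob_some_surplus_less_le:
  fixes d :: real
  assumes n: "n > 0" and j: "j > 0" and d: "d \<le> t"
  shows "measure_pmf.prob (random_constraints n m :: 'k::finite constraint list pmf)
      {xs. \<exists>J\<subseteq>{..<m}. card J = j \<and> csp_surplus ((!) xs) t {} J < d * j}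
    \<le> failure_ratio CARD('k) ((t - d) / 2) n m j ^ j"
proof -
  let ?M = "measure_pmf (random_constraints n m :: 'k constraint list pmf)"
  let ?\<theta> = "(t - d) / 2" and ?k = "CARD('k)"
  let ?bad = "\<lambda>J. {xs :: 'k constraint list. csp_surplus ((!) xs) t {} J < d * j}"
  let ?\<J> = "{J. J \<subseteq> {..<m} \<and> card J = j}"
  have finite: "finite ?\<J>" by (rule finite_subset[of _ "Pow {..<m}"]) auto
  have pos: "0 < real (?k * j) / n" using j n by simp
  have "{xs :: 'k constraint list. \<exists>J\<subseteq>{..<m}. card J = j \<and> csp_surplus ((!) xs) t {} J < d * j} =
      (\<Union>J\<in>?\<J>. ?bad J)"
    by auto
  hence "measure ?M {xs. \<exists>J\<subseteq>{..<m}. card J = j \<and> csp_surplus ((!) xs) t {} J < d * j} \<le>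
      (\<Sum>J\<in>?\<J>. measure ?M (?bad J))"
    using finite by (auto intro: measure_pmf.finite_measure_subadditive_finite)
  also have "\<dots> \<le> (\<Sum>J\<in>?\<J>. exp (real (?k * j)) * (real (?k * j) / n) powr (?\<theta> * j))"
  proof (rule sum_mono)
    fix J assume "J \<in> ?\<J>"
    thus "measure ?M (?bad J) \<le> exp (real (?k * j)) * (real (?k * j) / n) powr (?\<theta> * j)"
      using prob_surplus_less_le[OF n _ d, of J m, where 'k = 'k] by auto
  qed
  also have "\<dots> = (m choose j) * (exp (real (?k * j)) * (real (?k * j) / n) powr (?\<theta> * j))"
    using n_subsets[of "{..<m}" j] by simp
  also have "\<dots> \<le> (exp 1 * m / j) ^ j * (exp (real (?k * j)) * (real (?k * j) / n) powr (?\<theta> * j))"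
    by (intro mult_right_mono binomial_le_exp_power) auto
  also have "\<dots> = (exp 1 * m / j * (exp ?k * (real (?k * j) / n) powr ?\<theta>)) ^ j"
  proof -
    have "(real (?k * j) / n) powr (?\<theta> * j) = ((real (?k * j) / n) powr ?\<theta>) ^ j"
      using pos by (subst powr_powr[symmetric]) (intro powr_realpow, simp only: powr_gt_zero)
    moreover have "exp (real (?k * j)) = exp ?k ^ j"
      by (simp add: exp_of_nat_mult[symmetric] mult.commute)
    ultimately show ?thesis by (simp only: power_mult_distrib)
  qed
  also have "exp 1 * m / j * (exp ?k * (real (?k * j) / n) powr ?\<theta>) = failure_ratio ?k ?\<theta> n m j"
    using j n by (simp add: failure_ratio_def powr_divide powr_mult powr_diff exp_add)
  finally show ?thesis .
qed

lemma failure_ratio_mono: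
  assumes "1 \<le> \<theta>" "j \<le> s"
  shows "failure_ratio k \<theta> n m j \<le> failure_ratio k \<theta> n m s"
  unfolding failure_ratio_def using assms
  by (intro divide_right_mono mult_left_mono powr_mono2) auto

lemma sum_power_le_double:
  fixes q :: real
  assumes "0 \<le> q" "q \<le> 1 / 2"
  shows "(\<Sum>j=1..s. q ^ j) \<le> 2 * q"
proof -
  have "(\<Sum>j<s. q ^ j) \<le> (\<Sum>j<s. (1 / 2) ^ j)" using assms by (intro sum_mono power_mono) auto
  also have "\<dots> \<le> 2" by (simp add: geometric_sum)
  finally have "q * (\<Sum>j<s. q ^ j) \<le> q * 2" using assms(1) by (rule mult_left_mono)
  thus ?thesis by (simp add: sum.atLeast1_atMost_eq sum_distrib_left mult.commute)
qed

lemma prob_not_expanding_le: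
  fixes d :: real
  assumes n: "n > 0" and d: "d \<le> real t - 2"
  shows "measure_pmf.prob (random_constraints n m :: 'k::finite constraint list pmf)
      {xs. \<not> csp_expanding ((!) xs) t {} {..<m} s (\<lambda>j. d * j)}
    \<le> 2 * failure_ratio CARD('k) ((t - d) / 2) n m s"
proof (cases "failure_ratio CARD('k) ((t - d) / 2) n m s \<le> 1 / 2")
  case True
  let ?M = "measure_pmf (random_constraints n m :: 'k constraint list pmf)"
  let ?q = "failure_ratio CARD('k) ((t - d) / 2) n m"
  let ?bad = "\<lambda>j. {xs :: 'k constraint list.
    \<exists>J\<subseteq>{..<m}. card J = j \<and> csp_surplus ((!) xs) t {} J < d * j}"
  have "measure ?M {xs. \<not> csp_expanding ((!) xs) t {} {..<m} s (\<lambda>j. d * j)} \<le>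
      measure ?M (\<Union>j\<in>{1..s}. ?bad j)"
  proof (rule measure_pmf.finite_measure_mono)
    show "{xs. \<not> csp_expanding ((!) xs) t {} {..<m} s (\<lambda>j. d * j)} \<subseteq> (\<Union>j\<in>{1..s}. ?bad j)"
    proof clarify
      fix xs :: "'k constraint list"
      assume "\<not> csp_expanding ((!) xs) t {} {..<m} s (\<lambda>j. d * j)"
      then obtain J where J: "J \<subseteq> {..<m}" "J \<noteq> {}" "card J \<le> s"
          "csp_surplus ((!) xs) t {} J < d * card J"
        by (auto simp: expanding_def not_le)
      have "0 < card J" using J(1,2) finite_subset by (fastforce simp: card_gt_0_iff)
      thus "xs \<in> (\<Union>j\<in>{1..s}. ?bad j)" using J by (intro UN_I[of "card J"]) auto
    qed
  qed simp
  also have "\<dots> \<le> (\<Sum>j=1..s. measure ?M (?bad j))"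
    by (intro measure_pmf.finite_measure_subadditive_finite) auto
  also have "\<dots> \<le> (\<Sum>j=1..s. ?q s ^ j)"
  proof (rule sum_mono)
    fix j assume j: "j \<in> {1..s}"
    hence "measure ?M (?bad j) \<le> ?q j ^ j" using n d by (intro prob_some_surplus_less_le) auto
    also have "\<dots> \<le> ?q s ^ j"
      using j d by (intro power_mono failure_ratio_mono failure_ratio_nonneg) auto
    finally show "measure ?M (?bad j) \<le> ?q s ^ j" .
  qed
  also have "\<dots> \<le> 2 * ?q s" using True by (intro sum_power_le_double failure_ratio_nonneg)
  finally show ?thesis .
next
  case False
  thus ?thesis by (intro order_trans[OF measure_pmf.prob_le_1]) simp
qed

lemma failure_ratio_tendsto_0:
  assumes m: "\<And>n. real (m n) \<le> real n powr \<alpha>" and s: "\<And>n. real (s n) \<le> c * real n powr \<gamma>"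
    and "1 \<le> \<theta>" "\<alpha> + \<gamma> * (\<theta> - 1) < \<theta>" "0 < c"
  shows "(\<lambda>n. failure_ratio k \<theta> n (m n) (s n)) \<longlonglongrightarrow> 0"
proof (rule tendsto_sandwich[where f = "\<lambda>_. 0"])
  define A where "A = exp (k + 1) * k powr \<theta> * c powr (\<theta> - 1)"
  define \<eta> where "\<eta> = \<theta> - \<alpha> - \<gamma> * (\<theta> - 1)"
  have "failure_ratio k \<theta> n (m n) (s n) \<le> A * real n powr (- \<eta>)" if "n > 0" for n
  proof -
    have "failure_ratio k \<theta> n (m n) (s n) \<le>
        exp (k + 1) * k powr \<theta> * n powr \<alpha> * (c * n powr \<gamma>) powr (\<theta> - 1) / n powr \<theta>"
      unfolding failure_ratio_def using m s assms(3)
      by (intro divide_right_mono mult_mono powr_mono2) auto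
    also have "\<dots> = A * (n powr \<alpha> * n powr (\<gamma> * (\<theta> - 1)) / n powr \<theta>)"
      using \<open>0 < c\<close> by (simp add: A_def powr_mult powr_powr)
    also have "\<dots> = A * n powr (- \<eta>)"
      by (simp add: \<eta>_def algebra_simps flip: powr_add powr_diff)
    finally show ?thesis .
  qed
  thus "\<forall>\<^sub>F n in sequentially. failure_ratio k \<theta> n (m n) (s n) \<le> A * real n powr (- \<eta>)"
    by (rule eventually_mono[OF eventually_gt_at_top])
  show "(\<lambda>n. A * real n powr (- \<eta>)) \<longlonglongrightarrow> 0"
    using assms(4) by (intro tendsto_mult_right_zero tendsto_neg_powr filterlim_real_sequentially)
      (auto simp: \<eta>_def)
qed (auto simp: failure_ratio_nonneg)

lemma tendsto_prob_expanding:
  fixes d :: real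
  assumes "d \<le> real t - 2"
    and "\<And>n. real (m n) \<le> real n powr \<alpha>" "\<And>n. real (s n) \<le> c * real n powr \<gamma>"
    and "\<alpha> + \<gamma> * ((t - d) / 2 - 1) < (t - d) / 2" "0 < c"
  shows "(\<lambda>n. measure_pmf.prob (random_constraints n (m n) :: 'k::finite constraint list pmf)
      {xs. csp_expanding ((!) xs) t {} {..<m n} (s n) (\<lambda>j. d * j)}) \<longlonglongrightarrow> 1"
proof -
  let ?M = "\<lambda>n. random_constraints n (m n) :: 'k constraint list pmf"
  let ?good = "\<lambda>n. {xs :: 'k constraint list.
    csp_expanding ((!) xs) t {} {..<m n} (s n) (\<lambda>j. d * j)}"
  have "(\<lambda>n. measure_pmf.prob (?M n) (- ?good n)) \<longlonglongrightarrow> 0"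
  proof (rule tendsto_sandwich[where f = "\<lambda>_. 0"])
    have "measure_pmf.prob (?M n) (- ?good n) \<le>
        2 * failure_ratio CARD('k) ((t - d) / 2) n (m n) (s n)"
      if "n > 0" for n
      using prob_not_expanding_le[OF that assms(1), where 'k = 'k] by (simp add: Collect_neg_eq)
    thus "\<forall>\<^sub>F n in sequentially. measure_pmf.prob (?M n) (- ?good n) \<le>
        2 * failure_ratio CARD('k) ((t - d) / 2) n (m n) (s n)"
      by (rule eventually_mono[OF eventually_gt_at_top])
    show "(\<lambda>n. 2 * failure_ratio CARD('k) ((t - d) / 2) n (m n) (s n)) \<longlonglongrightarrow> 0"
      using assms by (intro tendsto_mult_right_zero failure_ratio_tendsto_0) auto
  qed auto
  hence "(\<lambda>n. 1 - measure_pmf.prob (?M n) (- ?good n)) \<longlonglongrightarrow> 1 - 0" by (intro tendsto_intros)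
  moreover have "1 - measure_pmf.prob (?M n) (- ?good n) = measure_pmf.prob (?M n) (?good n)" for n
    using measure_pmf.prob_compl[of "?good n" "?M n"] by (simp add: Compl_eq_Diff_UNIV)
  ultimately show ?thesis by simp
qed

lemma nat_floor_powr_in_bigomega:
  assumes "0 < \<gamma>"
  shows "(\<lambda>n. real (nat \<lfloor>real n powr \<gamma>\<rfloor>)) \<in> \<Omega>(\<lambda>n. real n powr \<gamma>)"
proof (rule landau_omega.bigI[of "1 / 2"])
  show "\<forall>\<^sub>F n in sequentially. 1 / 2 * norm (real n powr \<gamma>) \<le> norm (real (nat \<lfloor>real n powr \<gamma>\<rfloor>))"
  proof (rule eventually_mono[OF eventually_gt_at_top[of 0]])
    fix n :: nat assume "0 < n"
    hence "1 \<le> real n powr \<gamma>" using assms by (intro ge_one_powr_ge_zero) auto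
    hence "1 \<le> \<lfloor>real n powr \<gamma>\<rfloor>" by simp
    hence "real n powr \<gamma> \<le> 2 * real_of_int \<lfloor>real n powr \<gamma>\<rfloor>" by linarith
    thus "1 / 2 * norm (real n powr \<gamma>) \<le> norm (real (nat \<lfloor>real n powr \<gamma>\<rfloor>))" by simp
  qed
qed simp

lemma expansion_exponent_less:
  fixes t \<epsilon> d :: real
  assumes "2 < t" "0 < d" "d \<le> \<epsilon>"
  shows "t / 2 - \<epsilon> + \<epsilon> / (t - 2) * ((t - d) / 2 - 1) < (t - d) / 2"
proof -
  define \<gamma> where "\<gamma> = \<epsilon> / (t - 2)"
  have "\<gamma> * (t - 2) = \<epsilon>" "0 < \<gamma> * d" using assms by (simp_all add: \<gamma>_def)
  thus ?thesis using assms(3) unfolding \<gamma>_def[symmetric] by (simp add: field_simps)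
qed

lemma exists_expansion_scale:
  fixes \<gamma> d b :: real
  assumes "0 < \<gamma>" "0 < d" "0 \<le> b"
  shows "\<exists>c s. 0 < c \<and> (\<forall>n. real (s n) \<le> c * real n powr \<gamma>) \<and>
    (\<forall>n>0. (4 * (real (nat \<lfloor>real n powr \<gamma>\<rfloor>) + 1) / d + 1) * b \<le> real (s n))"
proof -
  define c where "c = (8 / d + 1) * b + 1"
  define s where "s n = nat \<lfloor>c * real n powr \<gamma>\<rfloor>" for n :: nat
  have c_pos: "0 < c" using assms(2,3) by (simp add: c_def add_nonneg_pos)
  have "(4 * (real (nat \<lfloor>real n powr \<gamma>\<rfloor>) + 1) / d + 1) * b \<le> real (s n)" if "n > 0" for n
  proof -
    let ?y = "real n powr \<gamma>"
    have y_ge_1: "1 \<le> ?y" using that assms(1) by (intro ge_one_powr_ge_zero) auto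
    have "real (nat \<lfloor>?y\<rfloor>) + 1 \<le> 2 * ?y" using y_ge_1 of_nat_floor[of ?y] by linarith
    hence "4 * (real (nat \<lfloor>?y\<rfloor>) + 1) / d \<le> 4 * (2 * ?y) / d"
      using assms(2) by (intro divide_right_mono mult_left_mono) auto
    hence "4 * (real (nat \<lfloor>?y\<rfloor>) + 1) / d + 1 \<le> 4 * (2 * ?y) / d + ?y" using y_ge_1 by simp
    hence "(4 * (real (nat \<lfloor>?y\<rfloor>) + 1) / d + 1) * b \<le> (4 * (2 * ?y) / d + ?y) * b"
      using assms(3) by (rule mult_right_mono)
    also have "\<dots> = c * ?y - ?y" by (simp add: c_def algebra_simps)
    also have "\<dots> \<le> real (s n)" unfolding s_def using y_ge_1 by linarith
    finally show ?thesis .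
  qed
  moreover have "real (s n) \<le> c * real n powr \<gamma>" for n using c_pos by (simp add: s_def)
  ultimately show ?thesis using c_pos by blast
qed

lemma prob_expanding_le_prob_rounds_nonempty:
  fixes P :: "('k::finite \<Rightarrow> bool) \<Rightarrow> bool" and d :: real
  assumes uniform: "wise_uniform (t - 1) \<mu>" and support: "set_pmf \<mu> \<subseteq> {z. P z}"
    and n: "0 < n" and d: "0 < d"
    and s: "(4 * (real r + 1) / d + 1) * (1 + CARD('k) / d) \<le> s"
  shows "measure_pmf.prob (random_constraints n m :: 'k constraint list pmf)
      {xs. csp_expanding ((!) xs) t {} {..<m} s (\<lambda>j. d * j)}
    \<le> measure_pmf.prob (random_instance n m) {I. (N_plus n ^^ r) (csp_polytope n P I) \<noteq> {}}"
proof -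
  let ?M = "random_constraints n m :: 'k constraint list pmf"
  have "measure_pmf.prob ?M {xs. csp_expanding ((!) xs) t {} {..<m} s (\<lambda>j. d * j)} \<le>
      measure_pmf.prob ?M {xs. (N_plus n ^^ r) (csp_polytope n P (mset xs)) \<noteq> {}}"
  proof (rule measure_pmf.finite_measure_mono_AE)
    show "AE xs in ?M. xs \<in> {xs. csp_expanding ((!) xs) t {} {..<m} s (\<lambda>j. d * j)} \<longrightarrow>
        xs \<in> {xs. (N_plus n ^^ r) (csp_polytope n P (mset xs)) \<noteq> {}}"
      unfolding AE_measure_pmf_iff
    proof (intro ballI impI, unfold mem_Collect_eq)
      fix xs assume xs: "xs \<in> set_pmf ?M"
        and expanding: "csp_expanding ((!) xs) t {} {..<m} s (\<lambda>j. d * j)"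
      note xs = set_pmf_random_constraints[OF n xs]
      interpret planted_csp P \<mu> t xs n d
        by unfold_locales (use xs d uniform support in auto)
      show "(N_plus n ^^ r) (csp_polytope n P (mset xs)) \<noteq> {}"
        using expanding xs(1) s by (intro rounds_nonempty[of s]) auto
    qed
  qed simp
  thus ?thesis by (simp add: random_instance_def vimage_def)
qed

lemma tendsto_prob_rounds_nonempty:
  fixes P :: "('k::finite \<Rightarrow> bool) \<Rightarrow> bool" and \<alpha> \<gamma> d :: real
  assumes \<mu>: "wise_uniform (t - 1) \<mu>" "set_pmf \<mu> \<subseteq> {z. P z}"
    and \<gamma>: "0 < \<gamma>" and d: "0 < d" "d \<le> real t - 2"
    and exponent: "\<alpha> + \<gamma> * ((t - d) / 2 - 1) < (t - d) / 2"
    and m: "\<And>n. real (m n) \<le> real n powr \<alpha>"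
  shows "(\<lambda>n. measure_pmf.prob (random_instance n (m n))
    {I. (N_plus n ^^ nat \<lfloor>real n powr \<gamma>\<rfloor>) (csp_polytope n P I) \<noteq> {}}) \<longlonglongrightarrow> 1"
proof -
  obtain c s where s: "0 < c" "\<And>n. real (s n) \<le> c * real n powr \<gamma>"
    "\<And>n. 0 < n \<Longrightarrow>
      (4 * (real (nat \<lfloor>real n powr \<gamma>\<rfloor>) + 1) / d + 1) * (1 + CARD('k) / d) \<le> real (s n)"
    using exists_expansion_scale[OF \<gamma> d(1), of "1 + CARD('k) / d"] d(1) by auto
  show ?thesis
  proof (rule tendsto_sandwich[OF _ _ tendsto_prob_expanding[OF d(2) m s(2) exponent s(1)]
        tendsto_const])
    show "\<forall>\<^sub>F n in sequentially.
        measure_pmf.prob (random_constraints n (m n) :: 'k constraint list pmf)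
          {xs. csp_expanding ((!) xs) t {} {..<m n} (s n) (\<lambda>j. d * j)}
        \<le> measure_pmf.prob (random_instance n (m n))
          {I. (N_plus n ^^ nat \<lfloor>real n powr \<gamma>\<rfloor>) (csp_polytope n P I) \<noteq> {}}"
      using prob_expanding_le_prob_rounds_nonempty[OF \<mu> _ d(1) s(3)]
      by (intro eventually_mono[OF eventually_gt_at_top[of 0]]) auto
  qed simp
qed

theorem theorem1p4:
  fixes P :: "('k::finite \<Rightarrow> bool) \<Rightarrow> bool"
    and t :: nat
    and \<epsilon> :: real
  assumes "t \<ge> 3"
    and "\<epsilon> > 0"
    and "uniform_supporting (t - 1) P"
  shows "\<exists>r :: nat \<Rightarrow> nat.
    (\<lambda>n. real (r n)) \<in> \<Omega>(\<lambda>n. real n powr (\<epsilon> / (real t - 2))) \<and>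
    (\<forall>m :: nat \<Rightarrow> nat. (\<forall>n. real (m n) \<le> real n powr (real t / 2 - \<epsilon>)) \<longrightarrow>
      (\<lambda>n. measure_pmf.prob (random_instance n (m n))
             {I. (N_plus n ^^ r n) (csp_polytope n P I) \<noteq> {}}) \<longlonglongrightarrow> 1)"
proof -
  obtain \<mu> :: "('k \<Rightarrow> bool) pmf" where \<mu>: "wise_uniform (t - 1) \<mu>" "set_pmf \<mu> \<subseteq> {z. P z}"
    using assms(3) by (auto simp: uniform_supporting_def wise_uniform_def)
  define \<gamma> where "\<gamma> = \<epsilon> / (real t - 2)"
  define d where "d = min \<epsilon> (1 / 2)"
  define r where "r n = nat \<lfloor>real n powr \<gamma>\<rfloor>" for n :: nat
  have \<gamma>: "0 < \<gamma>" and d: "0 < d" "d \<le> \<epsilon>" "d \<le> real t - 2"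
    using assms(1,2) by (auto simp: \<gamma>_def d_def)
  have exponent: "real t / 2 - \<epsilon> + \<gamma> * ((t - d) / 2 - 1) < (t - d) / 2"
    unfolding \<gamma>_def using assms(1) d by (intro expansion_exponent_less) auto
  have "(\<lambda>n. real (r n)) \<in> \<Omega>(\<lambda>n. real n powr \<gamma>)"
    unfolding r_def by (rule nat_floor_powr_in_bigomega[OF \<gamma>])
  moreover have "(\<lambda>n. measure_pmf.prob (random_instance n (m n))
      {I. (N_plus n ^^ r n) (csp_polytope n P I) \<noteq> {}}) \<longlonglongrightarrow> 1"
    if "\<forall>n. real (m n) \<le> real n powr (real t / 2 - \<epsilon>)" for m
    unfolding r_def using that by (intro tendsto_prob_rounds_nonempty[OF \<mu> \<gamma> d(1,3) exponent]) blast
  ultimately show ?thesis unfolding \<gamma>_def[symmetric] by blast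
qed

end
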